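(* Let $\mathcal A=(H_1,\dots,H_n)$ be an arrangement of tropical pseudohyperplanes in $\mathbb T^{d-1}$ such that the set of types of points with respect to $\mathcal A$ equals the set of cell types of a fine mixed subdivision of $n\Delta_{d-1}$. Then the set of types of $\mathcal A$ satisfies the elimination axiom: for any two types $A,B$ of $\mathcal A$ and any $j\in[n]$ there is a type $C$ of $\mathcal A$ with $C_j=A_j\cup B_j$ and $C_k\in\{A_k,B_k,A_k\cup B_k\}$ for all $k\in[n]$.
   Context: $\mathbb T^{d-1}$ denotes the compactified tropical projective space, with interior $\mathbb R^d/\mathbb R(1,\dots,1)\cong\mathbb R^{d-1}$. A tropical hyperplane has $d$ open sectors labelled $1,\dots,d$. A tropical pseudohyperplane is the image of a tropical hyperplane under a PL-homeomorphism of $\mathbb T^{d-1}$ fixing the boundary; its sectors $S_1,\dots,S_d$ are the images of the sectors. The type of a point $p$ with respect to $(H_1,\dots,H_n)$ is $(A_1,\dots,A_n)$ with $A_i$ the set of $j$ such that $p$ lies in the closure of the $j$-th sector of $H_i$. For $\emptyset\ne I\subsetneq[d]$, $H_I=\partial\,\overline{\bigcup_{i\in I}S_i}$, a pseudohyperplane with sides $\overline{\bigcup_{i\in I}S_i}\setminus H_I$ and $\overline{\bigcup_{i\notin I}S_i}\setminus H_I$. A pseudohyperplane is a set PL-homeomorphic to a linear hyperplane. A finite family $(H_e)_{e\in E}$ of pseudohyperplanes is an arrangement of linear pseudohyperplanes if (1) every $H_A=\bigcap_{e\in A}H_e$ ($A\subseteq E$) is a pseudohyperplane of smaller dimension; (2)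 if $H_A\not\subseteq H_e$ then $H_A\cap H_e$ is a pseudohyperplane in $H_A$ with sides $H_A\cap H_e^{\pm}$; (3) any intersection of closed sides is a ball. An arrangement of affine pseudohyperplanes is a family each of whose subfamilies has empty intersection or is an arrangement of linear pseudohyperplanes. A family $(H_1,\dots,H_n)$ of tropical pseudohyperplanes is an arrangement of tropical pseudohyperplanes if for every $\mathcal I=(I_1,\dots,I_n)$ with $\emptyset\ne I_i\subsetneq[d]$, the family $\{(H_i)_{I_i}\}_{i\in[n]}$ is an arrangement of affine pseudohyperplanes. Mixed subdivisions: with $\Delta_J=\mathrm{conv}\{e_j:j\in J\}$, a mixed subdivision of $n\Delta_{d-1}$ is a polyhedral subdivision into cells $\Delta_{A_1}+\dots+\Delta_{A_n}$ (type $(A_1,\dots,A_n)$) with any two cells of types $A,B$ intersecting in $\sum_i(\Delta_{A_i}\cap\Delta_{B_i})$; it is fine if no other mixed subdivision refines it. *)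

theory Defs
  imports "HOL-Analysis.Analysis"
begin

section \<open>Piecewise linear maps\<close>

text \<open>
  The cover is required to be locally finite at the points of \<open>X\<close>. Since its members are
  closed, a map satisfying this definition is automatically continuous on \<open>X\<close>.
\<close>

definition pl_on :: "'a::euclidean_space set \<Rightarrow> ('a \<Rightarrow> 'b::euclidean_space) \<Rightarrow> bool" where
  "pl_on X f \<longleftrightarrow>
     (\<exists>\<F>. \<Union>\<F> = X \<and> (\<forall>P\<in>\<F>. polyhedron P) \<and>
          (\<forall>x\<in>X. \<exists>U. open U \<and> x \<in> U \<and> finite {P\<in>\<F>. P \<inter> U \<noteq> {}}) \<and>
          (\<forall>P\<in>\<F>. \<exists>l b. linear l \<and> (\<forall>x\<in>P. f x = l x + b)))"

definition pl_homeomorphism ::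
  "'a::euclidean_space set \<Rightarrow> 'b::euclidean_space set \<Rightarrow> ('a \<Rightarrow> 'b) \<Rightarrow> ('b \<Rightarrow> 'a) \<Rightarrow> bool" where
  "pl_homeomorphism X Y f g \<longleftrightarrow> homeomorphism X Y f g \<and> pl_on X f \<and> pl_on Y g"

definition pl_homeomorphic :: "'a::euclidean_space set \<Rightarrow> 'b::euclidean_space set \<Rightarrow> bool" where
  "pl_homeomorphic X Y \<longleftrightarrow> (\<exists>f g. pl_homeomorphism X Y f g)"


section \<open>Compactified tropical projective space\<close>

text \<open>
  The compactified space is the quotient of the vectors over the reals extended by
  \<open>-\<infinity>\<close>, not all of whose entries are \<open>-\<infinity>\<close>, by the translations along \<open>(1, \<dots>, 1)\<close>.
  Each class has exactly one representative whose largest coordinate is \<open>0\<close>, and the set of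
  these representatives, with the subspace topology, is homeomorphic to the quotient.
\<close>

definition tp_space :: "(ereal ^ 'd::finite) set" where
  "tp_space = {x. Max (range (($) x)) = 0}"

definition tp_boundary :: "(ereal ^ 'd::finite) set" where
  "tp_boundary = {x \<in> tp_space. \<exists>i. x $ i = -\<infinity>}"

text \<open>
  The interior is the real quotient by the line spanned by \<open>(1, \<dots>, 1)\<close>. Its linear (hence PL)
  structure is expressed on the complementary subspace \<open>tp_linear\<close> of vectors with coordinate
  sum \<open>0\<close>, a vector \<open>v\<close> of which stands for the class \<open>tp_point v\<close>.
\<close>

definition tp_linear :: "(real ^ 'd::finite) set" where
  "tp_linear = {v. (\<Sum>i\<in>UNIV. v $ i) = 0}"

definition tp_point :: "real ^ 'd::finite \<Rightarrow> ereal ^ 'd" where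
  "tp_point v = (\<chi> i. ereal (v $ i - Max (range (($) v))))"

definition tp_interior_part :: "(ereal ^ 'd::finite) set \<Rightarrow> (real ^ 'd) set" where
  "tp_interior_part X = {v \<in> tp_linear. tp_point v \<in> X}"

text \<open>PL-homeomorphisms of the compactified space which fix its boundary pointwise.\<close>

definition tp_pl_homeomorphism :: "(ereal ^ 'd::finite \<Rightarrow> ereal ^ 'd) \<Rightarrow> bool" where
  "tp_pl_homeomorphism \<phi> \<longleftrightarrow>
     (\<exists>\<psi>. homeomorphism tp_space tp_space \<phi> \<psi>) \<and>
     (\<exists>f g. pl_homeomorphism tp_linear tp_linear f g \<and>
            (\<forall>v\<in>tp_linear. \<phi> (tp_point v) = tp_point (f v))) \<and>
     (\<forall>x\<in>tp_boundary. \<phi> x = x)"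


section \<open>Tropical hyperplanes and pseudohyperplanes\<close>

text \<open>
  The max convention, matching the compactification by \<open>-\<infinity>\<close>: the hyperplane with apex
  \<open>a\<close> consists of the points where the maximum of the \<open>x\<^sub>i - a\<^sub>i\<close> is attained at least twice.
\<close>

definition tropical_hyperplane :: "real ^ 'd::finite \<Rightarrow> (ereal ^ 'd) set" where
  "tropical_hyperplane a =
     {x \<in> tp_space. \<exists>i j. i \<noteq> j \<and> x $ i - ereal (a $ i) = x $ j - ereal (a $ j) \<and>
        (\<forall>k. x $ k - ereal (a $ k) \<le> x $ i - ereal (a $ i))}"

definition tropical_sector :: "real ^ 'd::finite \<Rightarrow> 'd \<Rightarrow> (ereal ^ 'd) set" where
  "tropical_sector a j =
     {x \<in> tp_space. \<forall>i. i \<noteq> j \<longrightarrow> x $ i - ereal (a $ i) < x $ j - ereal (a $ j)}"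

text \<open>A pseudohyperplane is given together with its labelled sectors.\<close>

definition tropical_pseudohyperplane ::
  "(ereal ^ 'd::finite) set \<Rightarrow> ('d \<Rightarrow> (ereal ^ 'd) set) \<Rightarrow> bool" where
  "tropical_pseudohyperplane H S \<longleftrightarrow>
     (\<exists>a \<phi>. tp_pl_homeomorphism \<phi> \<and> H = \<phi> ` tropical_hyperplane a \<and>
            (\<forall>j. S j = \<phi> ` tropical_sector a j))"

definition type_of_point ::
  "('n \<Rightarrow> 'd \<Rightarrow> (ereal ^ 'd::finite) set) \<Rightarrow> ereal ^ 'd \<Rightarrow> 'n \<Rightarrow> 'd set" where
  "type_of_point S p = (\<lambda>i. {j. p \<in> top_of_set tp_space closure_of S i j})"

definition tropical_types ::
  "('n \<Rightarrow> 'd \<Rightarrow> (ereal ^ 'd::finite) set) \<Rightarrow> ('n \<Rightarrow> 'd set) set" where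
  "tropical_types S = type_of_point S ` tp_space"

definition sector_union ::
  "('d \<Rightarrow> (ereal ^ 'd::finite) set) \<Rightarrow> 'd set \<Rightarrow> (ereal ^ 'd) set" where
  "sector_union S I = top_of_set tp_space closure_of (\<Union>i\<in>I. S i)"

definition sector_hyperplane ::
  "('d \<Rightarrow> (ereal ^ 'd::finite) set) \<Rightarrow> 'd set \<Rightarrow> (ereal ^ 'd) set" where
  "sector_hyperplane S I = top_of_set tp_space frontier_of sector_union S I"

definition sector_side ::
  "('d \<Rightarrow> (ereal ^ 'd::finite) set) \<Rightarrow> 'd set \<Rightarrow> (ereal ^ 'd) set" where
  "sector_side S I = sector_union S I - sector_hyperplane S I"


section \<open>Arrangements of pseudohyperplanes\<close>

text \<open>
  The pseudohyperplanes considered here are subsets of the compactified space. Being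
  PL-homeomorphic to a linear space is a condition on their part in the interior; being a ball is
  a condition on compact subsets of the whole space.
\<close>

definition pseudo_flat :: "nat \<Rightarrow> (ereal ^ 'd::finite) set \<Rightarrow> bool" where
  "pseudo_flat k X \<longleftrightarrow>
     (\<exists>L :: (real ^ 'd) set. subspace L \<and> dim L = k \<and> pl_homeomorphic (tp_interior_part X) L)"

definition tp_ball :: "(ereal ^ 'd::finite) set \<Rightarrow> bool" where
  "tp_ball X \<longleftrightarrow> (\<exists>L :: (real ^ 'd) set. subspace L \<and> X homeomorphic (L \<inter> cball 0 1))"

definition flat_intersection :: "('e \<Rightarrow> (ereal ^ 'd::finite) set) \<Rightarrow> 'e set \<Rightarrow> (ereal ^ 'd) set" where
  "flat_intersection H A = tp_space \<inter> (\<Inter>e\<in>A. H e)"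

text \<open>\<open>P e\<close> and \<open>N e\<close> are the two sides of \<open>H e\<close>, and \<open>P e \<union> H e\<close> and \<open>N e \<union> H e\<close> its closed sides.\<close>

definition linear_pseudo_arrangement ::
  "'e set \<Rightarrow> ('e \<Rightarrow> (ereal ^ 'd::finite) set) \<Rightarrow> ('e \<Rightarrow> (ereal ^ 'd) set) \<Rightarrow>
   ('e \<Rightarrow> (ereal ^ 'd) set) \<Rightarrow> bool" where
  "linear_pseudo_arrangement E H P N \<longleftrightarrow>
     finite E \<and>
     (\<forall>e\<in>E. pseudo_flat (CARD('d) - 2) (H e)) \<and>
     (\<forall>A\<subseteq>E. A \<noteq> {} \<longrightarrow> (\<exists>k < CARD('d) - 1. pseudo_flat k (flat_intersection H A))) \<and>
     (\<forall>A\<subseteq>E. \<forall>e\<in>E. \<not> flat_intersection H A \<subseteq> H e \<longrightarrow>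
        (let X = flat_intersection H A;
             X\<^sub>P = tp_interior_part (X \<inter> P e);
             X\<^sub>N = tp_interior_part (X \<inter> N e)
         in (\<exists>k. pseudo_flat (Suc k) X \<and> pseudo_flat k (X \<inter> H e)) \<and>
            X\<^sub>P \<noteq> X\<^sub>N \<and> components (tp_interior_part (X - H e)) = {X\<^sub>P, X\<^sub>N})) \<and>
     (\<forall>A\<subseteq>E. \<forall>B\<subseteq>E. tp_ball (tp_space \<inter> (\<Inter>e\<in>A. P e \<union> H e) \<inter> (\<Inter>e\<in>B. N e \<union> H e)))"

definition affine_pseudo_arrangement ::
  "'e set \<Rightarrow> ('e \<Rightarrow> (ereal ^ 'd::finite) set) \<Rightarrow> ('e \<Rightarrow> (ereal ^ 'd) set) \<Rightarrow>
   ('e \<Rightarrow> (ereal ^ 'd) set) \<Rightarrow> bool" where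
  "affine_pseudo_arrangement E H P N \<longleftrightarrow>
     finite E \<and>
     (\<forall>F\<subseteq>E. flat_intersection H F = {} \<or> linear_pseudo_arrangement F H P N)"

definition tropical_pseudo_arrangement ::
  "('n::finite \<Rightarrow> (ereal ^ 'd::finite) set) \<Rightarrow> ('n \<Rightarrow> 'd \<Rightarrow> (ereal ^ 'd) set) \<Rightarrow> bool" where
  "tropical_pseudo_arrangement H S \<longleftrightarrow>
     (\<forall>i. tropical_pseudohyperplane (H i) (S i)) \<and>
     (\<forall>I :: 'n \<Rightarrow> 'd set. (\<forall>i. I i \<noteq> {} \<and> I i \<noteq> UNIV) \<longrightarrow>
        affine_pseudo_arrangement UNIV (\<lambda>i. sector_hyperplane (S i) (I i))
          (\<lambda>i. sector_side (S i) (I i)) (\<lambda>i. sector_side (S i) (- I i)))"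


section \<open>Mixed subdivisions\<close>

definition Delta :: "'d set \<Rightarrow> (real ^ 'd::finite) set" where
  "Delta J = convex hull ((\<lambda>j. axis j 1) ` J)"

definition minkowski_sum :: "('n::finite \<Rightarrow> (real ^ 'd::finite) set) \<Rightarrow> (real ^ 'd) set" where
  "minkowski_sum X = {\<Sum>i\<in>UNIV. x i | x. \<forall>i. x i \<in> X i}"

definition mixed_cell :: "('n::finite \<Rightarrow> 'd set) \<Rightarrow> (real ^ 'd::finite) set" where
  "mixed_cell A = minkowski_sum (\<lambda>i. Delta (A i))"

definition polyhedral_subdivision :: "'a::euclidean_space set \<Rightarrow> 'a set set \<Rightarrow> bool" where
  "polyhedral_subdivision Q \<C> \<longleftrightarrow>
     finite \<C> \<and> \<Union>\<C> = Q \<and>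
     (\<forall>X\<in>\<C>. polytope X \<and> X \<noteq> {}) \<and>
     (\<forall>X\<in>\<C>. \<forall>F. F face_of X \<and> F \<noteq> {} \<longrightarrow> F \<in> \<C>) \<and>
     (\<forall>X\<in>\<C>. \<forall>Y\<in>\<C>. (X \<inter> Y) face_of X \<and> (X \<inter> Y) face_of Y)"

text \<open>A mixed subdivision is represented by the set of types of all its cells, of every dimension.\<close>

definition mixed_subdivision :: "('n::finite \<Rightarrow> 'd::finite set) set \<Rightarrow> bool" where
  "mixed_subdivision M \<longleftrightarrow>
     (\<forall>A\<in>M. \<forall>i. A i \<noteq> {}) \<and>
     polyhedral_subdivision ((\<lambda>x. real CARD('n) *\<^sub>R x) ` Delta UNIV) (mixed_cell ` M) \<and>
     (\<forall>A\<in>M. \<forall>B\<in>M. mixed_cell A \<inter> mixed_cell B = minkowski_sum (\<lambda>i. Delta (A i) \<inter> Delta (B i)))"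

text \<open>
  Refinement has to compare types and not just the underlying sets: different mixed subdivisions
  may have the same cells as sets, with different types.
\<close>

definition mixed_refines :: "('n \<Rightarrow> 'd set) set \<Rightarrow> ('n \<Rightarrow> 'd set) set \<Rightarrow> bool" where
  "mixed_refines M' M \<longleftrightarrow> (\<forall>B\<in>M'. \<exists>A\<in>M. \<forall>i. B i \<subseteq> A i)"

definition fine_mixed_subdivision :: "('n::finite \<Rightarrow> 'd::finite set) set \<Rightarrow> bool" where
  "fine_mixed_subdivision M \<longleftrightarrow>
     mixed_subdivision M \<and> (\<forall>M'. mixed_subdivision M' \<and> mixed_refines M' M \<longrightarrow> M' = M)"

end

theory Submission
  imports Defs
begin

text \<open>
  Elimination already holds for the types of any fine mixed subdivision. A point of the mixed cell
  of type \<open>A\<close> is the vector of column sums of a transport plan, a nonnegative matrix with unit row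
  sums supported on \<open>A\<close>. Fineness makes these plans unique and the set of types closed under
  passing to smaller types: otherwise the subdivision could be refined by minimising a single
  entry of the plan.

  Uniqueness persists when the row sums vary. Locally around a plan, the possible continuations do
  not depend on the row sums, so plans can be continued along segments in the space of row and
  column sums, and two different plans with equal sums would be transported to two different ones
  with unit row sums. In the limit this covers row sums that may vanish (comparability).

  For types \<open>A \<noteq> B\<close>, moving from an interior point of cell \<open>A\<close> towards one of cell \<open>B\<close> leads into a
  cell of some type \<open>C \<supseteq> A\<close>. By comparability, in the digraph with arcs \<open>k \<rightarrow> c\<close> for
  \<open>c \<in> B k\<close> and \<open>c \<rightarrow> k\<close> for \<open>c \<in> C k\<close>, arcs on closed walks belong to both types. Counting the
  flow into the vertices reachable from a maximal relevant vertex shows that \<open>C\<close> contains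
  \<open>A \<union> B\<close> on a nonempty set of positions where \<open>A\<close> and \<open>B\<close> differ. Replacing \<open>A\<close> by \<open>B\<close> at these
  positions gives a type closer to \<open>B\<close>, and iteration reaches every position.
\<close>

section \<open>Transport plans\<close>

definition row_sums :: "real ^ 'd ^ 'n \<Rightarrow> real ^ 'n" where
  "row_sums f = (\<chi> k. \<Sum>c\<in>UNIV. f $ k $ c)"

definition col_sums :: "real ^ 'd ^ 'n \<Rightarrow> real ^ 'd" where
  "col_sums f = (\<Sum>k\<in>UNIV. f $ k)"

definition supported :: "('n \<Rightarrow> 'd set) \<Rightarrow> real ^ 'd ^ 'n \<Rightarrow> bool" where
  "supported A f \<longleftrightarrow> (\<forall>k c. c \<notin> A k \<longrightarrow> f $ k $ c = 0)"

definition plan :: "('n \<Rightarrow> 'd set) \<Rightarrow> real ^ 'd ^ 'n \<Rightarrow> bool" where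
  "plan A f \<longleftrightarrow> supported A f \<and> (\<forall>k c. 0 \<le> f $ k $ c)"

definition unit_plans :: "('n \<Rightarrow> 'd set) \<Rightarrow> (real ^ 'd ^ 'n) set" where
  "unit_plans A = {f. plan A f \<and> row_sums f = 1}"

text \<open>For \<open>u = 1\<close> the plan is positive on every edge of \<open>A\<close>, so if
  no row is empty its column sums are a relative interior point of the mixed cell. For general
  \<open>u\<close> it serves as a correction term with prescribed row sums.\<close>

definition uniform_plan :: "('n \<Rightarrow> 'd set) \<Rightarrow> real ^ 'n \<Rightarrow> real ^ 'd ^ 'n" where
  "uniform_plan A u = (\<chi> k c. if c \<in> A k then u $ k / real (card (A k)) else 0)"

definition edge_plan :: "'n \<Rightarrow> 'd \<Rightarrow> real ^ 'd ^ 'n" where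
  "edge_plan k c = (\<chi> k' c'. if k' = k \<and> c' = c then 1 else 0)"

lemma row_sums_nth: "row_sums f $ k = (\<Sum>c\<in>UNIV. f $ k $ c)"
  by (simp add: row_sums_def)

lemma col_sums_nth: "col_sums f $ c = (\<Sum>k\<in>UNIV. f $ k $ c)"
  by (simp add: col_sums_def)

lemma linear_row_sums: "linear row_sums"
  by (intro linearI) (simp_all add: vec_eq_iff row_sums_nth sum.distrib sum_distrib_left)

lemma linear_col_sums: "linear col_sums"
  by (intro linearI) (simp_all add: vec_eq_iff col_sums_nth sum.distrib sum_distrib_left)

lemmas row_sums_add = linear_add[OF linear_row_sums]
  and row_sums_diff = linear_diff[OF linear_row_sums]
  and row_sums_scaleR = linear_scale[OF linear_row_sums]
  and col_sums_add = linear_add[OF linear_col_sums]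
  and col_sums_diff = linear_diff[OF linear_col_sums]
  and col_sums_scaleR = linear_scale[OF linear_col_sums]

lemmas sums_linear = row_sums_add row_sums_diff row_sums_scaleR col_sums_add col_sums_diff
  col_sums_scaleR

lemma continuous_on_row_sums [continuous_intros]:
  "continuous_on X g \<Longrightarrow> continuous_on X (\<lambda>x. row_sums (g x))"
  by (metis linear_conv_bounded_linear linear_continuous_on linear_row_sums continuous_on_compose2 subset_UNIV)

lemma continuous_on_col_sums [continuous_intros]:
  "continuous_on X g \<Longrightarrow> continuous_on X (\<lambda>x. col_sums (g x))"
  by (metis linear_conv_bounded_linear linear_continuous_on linear_col_sums continuous_on_compose2 subset_UNIV)

lemma sum_row_sums: "(\<Sum>k\<in>UNIV. row_sums f $ k) = (\<Sum>c\<in>UNIV. col_sums f $ c)"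
  unfolding row_sums_nth col_sums_nth by (rule sum.swap)

lemma plan_nonneg: "plan A f \<Longrightarrow> 0 \<le> f $ k $ c"
  by (simp add: plan_def)

lemma supported_mono: "supported A f \<Longrightarrow> (\<And>k. A k \<subseteq> B k) \<Longrightarrow> supported B f"
  by (auto simp: supported_def)

lemma plan_mono: "plan A f \<Longrightarrow> (\<And>k. A k \<subseteq> B k) \<Longrightarrow> plan B f"
  by (auto simp: plan_def intro: supported_mono)

lemma supported_add: "supported A f \<Longrightarrow> supported A g \<Longrightarrow> supported A (f + g)"
  by (simp add: supported_def)

lemma supported_diff: "supported A f \<Longrightarrow> supported A g \<Longrightarrow> supported A (f - g)"
  by (simp add: supported_def)

lemma supported_scaleR: "supported A f \<Longrightarrow> supported A (r *\<^sub>R f)"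
  by (simp add: supported_def)

lemma supported_uniform: "supported A (uniform_plan A u)"
  by (simp add: supported_def uniform_plan_def)

lemma uniform_nth: "uniform_plan A u $ k $ c = (if c \<in> A k then u $ k / real (card (A k)) else 0)"
  by (simp add: uniform_plan_def)

lemma row_sums_uniform:
  fixes A :: "'n::finite \<Rightarrow> 'd::finite set"
  assumes "\<And>k. A k \<noteq> {}"
  shows "row_sums (uniform_plan A u) = u"
proof -
  have "card (A k) > 0" for k using assms by (simp add: card_gt_0_iff)
  then show ?thesis using assms by (simp add: vec_eq_iff row_sums_nth uniform_nth sum.If_cases)
qed

lemma uniform_one_pos: 
  fixes A :: "'n::finite \<Rightarrow> 'd::finite set"
  assumes "c \<in> A k"
  shows "0 < uniform_plan A 1 $ k $ c"
proof -
  have "card (A k) > 0" using assms by (auto simp: card_gt_0_iff)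
  then show ?thesis using assms by (simp add: uniform_nth)
qed

lemma uniform_one_le: "uniform_plan A 1 $ k $ c \<le> 1"
  by (cases "card (A k)") (auto simp: uniform_nth)

lemma uniform_one_nonneg: "0 \<le> uniform_plan A 1 $ k $ c"
  by (simp add: uniform_nth)

lemma uniform_in_unit_plans:
  fixes A :: "'n::finite \<Rightarrow> 'd::finite set"
  assumes "\<And>k. A k \<noteq> {}"
  shows "uniform_plan A 1 \<in> unit_plans A"
  using assms by (simp add: unit_plans_def plan_def supported_uniform row_sums_uniform uniform_one_nonneg)

lemma row_sums_edge: "row_sums (edge_plan k c) = axis k 1"
  by (simp add: vec_eq_iff row_sums_nth edge_plan_def axis_def)

lemma col_sums_edge: "col_sums (edge_plan k c) = axis c 1"
  by (simp add: vec_eq_iff col_sums_nth edge_plan_def axis_def)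

lemma plan_le_row_sum:
  assumes "plan A f" shows "f $ k $ c \<le> row_sums f $ k"
  unfolding row_sums_nth using assms
  by (intro member_le_sum) (auto simp: plan_def)

lemma plan_norm_bound:
  fixes f :: "real ^ 'd::finite ^ 'n::finite"
  assumes "plan A f"
  shows "norm f \<le> (\<Sum>k\<in>UNIV. row_sums f $ k)"
proof -
  have "norm f \<le> (\<Sum>k\<in>UNIV. norm (f $ k))"
    by (simp add: norm_vec_def L2_set_le_sum)
  also have "\<dots> \<le> (\<Sum>k\<in>UNIV. row_sums f $ k)"
  proof (rule sum_mono)
    fix k
    have "norm (f $ k) \<le> (\<Sum>c\<in>UNIV. \<bar>f $ k $ c\<bar>)" by (rule norm_le_l1_cart)
    then show "norm (f $ k) \<le> row_sums f $ k"
      using assms by (simp add: row_sums_nth plan_def)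
  qed
  finally show ?thesis .
qed

lemma closed_plan: "closed {f. plan A f}"
  unfolding plan_def supported_def
  by (intro closed_Collect_conj closed_Collect_all closed_Collect_imp closed_Collect_eq
      closed_Collect_le continuous_intros open_Collect_const)

lemma compact_unit_plans: "compact (unit_plans A)"
proof (rule compact_eq_bounded_closed[THEN iffD2], rule conjI)
  show "bounded (unit_plans A)"
    unfolding bounded_iff unit_plans_def by (metis (mono_tags) mem_Collect_eq plan_norm_bound)
  have "closed ({f. plan A f} \<inter> {f. row_sums f = 1})"
    by (intro closed_Int closed_plan closed_Collect_eq continuous_intros)
  then show "closed (unit_plans A)" by (simp add: unit_plans_def Collect_conj_eq)
qed

section \<open>Walks in bipartite graphs and edge potentials\<close>

text \<open>\<open>X\<close> governs the arcs from rows to columns and \<open>Y\<close> the arcs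
  back. Two types in these places are compared with each other; admissible edges for
  \<open>X\<close> and positive edges for \<open>Y\<close> give a residual graph.\<close>

definition walk_step :: "('n \<Rightarrow> 'd set) \<Rightarrow> ('n \<Rightarrow> 'd set) \<Rightarrow> (('n + 'd) \<times> ('n + 'd)) set" where
  "walk_step X Y = {(Inl k, Inr c) |k c. c \<in> X k} \<union> {(Inr c, Inl k) |k c. c \<in> Y k}"

text \<open>\<open>h\<close> and \<open>g\<close> count the traversals of each edge in the two directions.\<close>

lemma walk_plans:
  fixes X Y :: "'n::finite \<Rightarrow> 'd::finite set"
  assumes "(u, v) \<in> (walk_step X Y)\<^sup>*"
  shows "\<exists>g h. plan Y g \<and> plan X h \<and>
    (\<forall>k. row_sums h $ k - row_sums g $ k = of_bool (u = Inl k) - of_bool (v = Inl k)) \<and>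
    (\<forall>c. col_sums g $ c - col_sums h $ c = of_bool (u = Inr c) - of_bool (v = Inr c))"
  using assms
proof (induction rule: rtrancl_induct)
  case base
  show ?case
    by (intro exI[of _ 0]) (simp add: plan_def supported_def row_sums_nth col_sums_nth)
next
  case (step y z)
  then obtain g h where gh: "plan Y g" "plan X h"
    "\<And>k. row_sums h $ k - row_sums g $ k = of_bool (u = Inl k) - of_bool (y = Inl k)"
    "\<And>c. col_sums g $ c - col_sums h $ c = of_bool (u = Inr c) - of_bool (y = Inr c)"
    by blast
  from step.hyps(2) consider k c where "y = Inl k" "z = Inr c" "c \<in> X k"
    | k c where "y = Inr c" "z = Inl k" "c \<in> Y k"
    by (auto simp: walk_step_def)
  then show ?case
  proof cases
    case 1
    have "plan X (h + edge_plan k c)" using gh(2) 1 by (auto simp: plan_def supported_def edge_plan_def)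
    moreover have "row_sums (h + edge_plan k c) $ k' - row_sums g $ k' =
        of_bool (u = Inl k') - of_bool (z = Inl k')" for k'
      using gh(3)[of k'] 1 by (auto simp: row_sums_add row_sums_edge axis_def)
    moreover have "col_sums g $ c' - col_sums (h + edge_plan k c) $ c' =
        of_bool (u = Inr c') - of_bool (z = Inr c')" for c'
      using gh(4)[of c'] 1 by (auto simp: col_sums_add col_sums_edge axis_def)
    ultimately show ?thesis using gh(1) by blast
  next
    case 2
    have "plan Y (g + edge_plan k c)" using gh(1) 2 by (auto simp: plan_def supported_def edge_plan_def)
    moreover have "row_sums h $ k' - row_sums (g + edge_plan k c) $ k' =
        of_bool (u = Inl k') - of_bool (z = Inl k')" for k'
      using gh(3)[of k'] 2 by (auto simp: row_sums_add row_sums_edge axis_def)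
    moreover have "col_sums (g + edge_plan k c) $ c' - col_sums h $ c' =
        of_bool (u = Inr c') - of_bool (z = Inr c')" for c'
      using gh(4)[of c'] 2 by (auto simp: col_sums_add col_sums_edge axis_def)
    ultimately show ?thesis using gh(2) by blast
  qed
qed

text \<open>
  Potentials singling out one edge. They exist for all edges iff the bipartite graph of \<open>A\<close> is a
  forest; they express each entry of a matrix supported on \<open>A\<close> through its row and column sums.
\<close>

definition edge_potentials :: "('n::finite \<Rightarrow> 'd::finite set) \<Rightarrow> bool" where
  "edge_potentials A \<longleftrightarrow> (\<forall>k0. \<forall>c0\<in>A k0. \<exists>(\<alpha> :: real ^ 'n) (\<beta> :: real ^ 'd).
     \<forall>k. \<forall>c\<in>A k. \<alpha> $ k + \<beta> $ c = of_bool (k = k0 \<and> c = c0))"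

text \<open>The potentials are summed against \<open>g\<close> in two ways: edge by edge only the
  entry at \<open>(k0, c0)\<close> survives, while grouping by rows and columns gives the two inner
  products.\<close>

lemma supported_entry:
  fixes A :: "'n::finite \<Rightarrow> 'd::finite set"
  assumes "edge_potentials A" "c0 \<in> A k0"
  shows "\<exists>\<alpha> \<beta>. \<forall>g. supported A g \<longrightarrow> g $ k0 $ c0 = \<alpha> \<bullet> row_sums g + \<beta> \<bullet> col_sums g"
proof -
  obtain \<alpha> :: "real ^ 'n" and \<beta> :: "real ^ 'd"
    where ab: "\<And>k c. c \<in> A k \<Longrightarrow> \<alpha> $ k + \<beta> $ c = of_bool (k = k0 \<and> c = c0)"
    using assms unfolding edge_potentials_def by blast
  have "g $ k0 $ c0 = \<alpha> \<bullet> row_sums g + \<beta> \<bullet> col_sums g" if "supported A g" for g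
  proof -
    have "\<alpha> \<bullet> row_sums g + \<beta> \<bullet> col_sums g =
      (\<Sum>k\<in>UNIV. \<Sum>c\<in>UNIV. \<alpha> $ k * g $ k $ c) + (\<Sum>c\<in>UNIV. \<Sum>k\<in>UNIV. \<beta> $ c * g $ k $ c)"
      by (simp add: inner_vec_def row_sums_nth col_sums_nth sum_distrib_left)
    also have "(\<Sum>c\<in>UNIV. \<Sum>k\<in>UNIV. \<beta> $ c * g $ k $ c) = (\<Sum>k\<in>UNIV. \<Sum>c\<in>UNIV. \<beta> $ c * g $ k $ c)"
      by (rule sum.swap)
    also have "(\<Sum>k\<in>UNIV. \<Sum>c\<in>UNIV. \<alpha> $ k * g $ k $ c) + \<dots>
        = (\<Sum>k\<in>UNIV. \<Sum>c\<in>UNIV. (\<alpha> $ k + \<beta> $ c) * g $ k $ c)"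
      by (simp add: sum.distrib algebra_simps)
    also have "\<dots> = (\<Sum>k\<in>UNIV. \<Sum>c\<in>UNIV. if k = k0 then (if c = c0 then g $ k $ c else 0) else 0)"
    proof (intro sum.cong refl)
      fix k c
      show "(\<alpha> $ k + \<beta> $ c) * g $ k $ c = (if k = k0 then (if c = c0 then g $ k $ c else 0) else 0)"
        using ab[of c k] that by (cases "c \<in> A k") (auto simp: supported_def)
    qed
    also have "\<dots> = (\<Sum>k\<in>UNIV. if k = k0 then (\<Sum>c\<in>UNIV. if c = c0 then g $ k $ c else 0) else 0)"
      by (intro sum.cong) auto
    also have "\<dots> = g $ k0 $ c0" by simp
    finally show ?thesis by simp
  qed
  then show ?thesis by blast
qed

lemma supported_eqI:
  fixes A :: "'n::finite \<Rightarrow> 'd::finite set"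
  assumes "edge_potentials A" "supported A f" "supported A g" "row_sums f = row_sums g" "col_sums f = col_sums g"
  shows "f = g"
proof -
  have "f $ k $ c = g $ k $ c" for k c
  proof (cases "c \<in> A k")
    case True
    then show ?thesis using supported_entry[OF assms(1) True] assms by metis
  next
    case False
    then show ?thesis using assms by (simp add: supported_def)
  qed
  then show ?thesis by (simp add: vec_eq_iff)
qed

section \<open>Continuation and comparability\<close>

text \<open>What elimination uses of a fine mixed subdivision, phrased through plans: the cells
  cover the dilated simplex, each point has a single plan across all cells, and the types are
  forests from which edges may be deleted as long as no row becomes empty.\<close>

locale plan_complex =
  fixes T :: "('n::finite \<Rightarrow> 'd::finite set) set"
  assumes nonempty: "A \<in> T \<Longrightarrow> A k \<noteq> {}"
    and cover: "(\<And>c. 0 \<le> \<nu> $ c) \<Longrightarrow> (\<Sum>c\<in>UNIV. \<nu> $ c) = real CARD('n) \<Longrightarrow>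
      \<exists>A\<in>T. \<nu> \<in> col_sums ` unit_plans A"
    and unit_unique: "A \<in> T \<Longrightarrow> B \<in> T \<Longrightarrow> f \<in> unit_plans A \<Longrightarrow> g \<in> unit_plans B \<Longrightarrow>
      col_sums f = col_sums g \<Longrightarrow> f = g"
    and downward: "A \<in> T \<Longrightarrow> (\<And>k. B k \<subseteq> A k) \<Longrightarrow> (\<And>k. B k \<noteq> {}) \<Longrightarrow> B \<in> T"
    and potentials: "A \<in> T \<Longrightarrow> edge_potentials A"
begin

text \<open>A Lipschitz constant common to all types, used to control how far a plan moves when its
  sums vary. It exists because entries are linear in the sums and there are finitely many
  types.\<close>

lemma supported_entry_bound:
  "\<exists>L\<ge>0. \<forall>A\<in>T. \<forall>g k c. supported A g \<longrightarrow>
     \<bar>g $ k $ c\<bar> \<le> L * (norm (row_sums g) + norm (col_sums g))"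
proof -
  have "\<exists>L\<ge>0. \<forall>g. supported A g \<longrightarrow> \<bar>g $ k $ c\<bar> \<le> L * (norm (row_sums g) + norm (col_sums g))"
    if AT: "A \<in> T" for A k c
  proof (cases "c \<in> A k")
    case True
    obtain \<alpha> \<beta> where ab: "\<And>g. supported A g \<Longrightarrow> g $ k $ c = \<alpha> \<bullet> row_sums g + \<beta> \<bullet> col_sums g"
      using supported_entry[OF potentials[OF AT] True] by blast
    have "\<bar>g $ k $ c\<bar> \<le> (norm \<alpha> + norm \<beta>) * (norm (row_sums g) + norm (col_sums g))"
      if "supported A g" for g
    proof -
      have "\<bar>g $ k $ c\<bar> \<le> norm \<alpha> * norm (row_sums g) + norm \<beta> * norm (col_sums g)"
        unfolding ab[OF that]
        by (rule order_trans[OF abs_triangle_ineq]) (intro add_mono Cauchy_Schwarz_ineq2)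
      moreover have "0 \<le> norm \<alpha> * norm (col_sums g)" "0 \<le> norm \<beta> * norm (row_sums g)" by simp_all
      ultimately show ?thesis unfolding distrib_left distrib_right by linarith
    qed
    then show ?thesis by (intro exI[of _ "norm \<alpha> + norm \<beta>"]) simp
  next
    case False
    then show ?thesis by (intro exI[of _ 0]) (simp add: supported_def)
  qed
  then have "\<exists>L. \<forall>A k c. A \<in> T \<longrightarrow> L A k c \<ge> 0 \<and> (\<forall>g. supported A g \<longrightarrow>
      \<bar>g $ k $ c\<bar> \<le> L A k c * (norm (row_sums g) + norm (col_sums g)))"
    by metis
  then obtain L where L: "\<And>A k c. A \<in> T \<Longrightarrow> L A k c \<ge> 0"
    "\<And>A k c g. A \<in> T \<Longrightarrow> supported A g \<Longrightarrow>
      \<bar>g $ k $ c\<bar> \<le> L A k c * (norm (row_sums g) + norm (col_sums g))"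
    by blast
  define L' where "L' = (\<Sum>A\<in>T. \<Sum>k\<in>UNIV. \<Sum>c\<in>UNIV. L A k c)"
  have le: "L A k c \<le> L'" if "A \<in> T" for A k c
  proof -
    have "L A k c \<le> (\<Sum>c\<in>UNIV. L A k c)" by (rule member_le_sum) (use L that in auto)
    also have "\<dots> \<le> (\<Sum>k\<in>UNIV. \<Sum>c\<in>UNIV. L A k c)"
      by (rule member_le_sum[where f = "\<lambda>k. \<Sum>c\<in>UNIV. L A k c"]) (use L that in \<open>auto intro: sum_nonneg\<close>)
    also have "\<dots> \<le> L'" unfolding L'_def
      by (rule member_le_sum[where f = "\<lambda>A. \<Sum>k\<in>UNIV. \<Sum>c\<in>UNIV. L A k c"])
        (use L that in \<open>auto intro!: sum_nonneg\<close>)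
    finally show ?thesis .
  qed
  have "0 \<le> L'" unfolding L'_def using L(1) by (intro sum_nonneg) auto
  moreover have "\<bar>g $ k $ c\<bar> \<le> L' * (norm (row_sums g) + norm (col_sums g))"
    if "A \<in> T" "supported A g" for A g k c
    using L(2)[OF that, of k c] le[OF that(1), of k c]
    by (meson add_nonneg_nonneg mult_right_mono norm_ge_zero order_trans)
  ultimately show ?thesis by blast
qed

text \<open>
  Perturbing a unit plan on the common part of both types by \<open>f\<close> and \<open>f'\<close> reduces to unit row sums.
\<close>

lemma eq_if_common_cell:
  assumes C: "C \<in> T" "C' \<in> T" "\<And>k. C k \<inter> C' k \<noteq> {}"
    and f: "plan C f" "plan C' f'" "row_sums f = row_sums f'" "col_sums f = col_sums f'"
  shows "f = f'"
proof -
  let ?A = "\<lambda>k. C k \<inter> C' k"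
  define x where "x = uniform_plan ?A 1"
  \<comment> \<open>\<open>w\<close> has the row sums of \<open>f\<close> and \<open>f'\<close> and
    lives on the common edges, where \<open>x\<close> is positive. So
    \<open>x + \<epsilon> *\<^sub>R (f - w)\<close> has unit row sums and stays nonnegative for
    small \<open>\<epsilon>\<close>.\<close>
  define w where "w = uniform_plan ?A (row_sums f)"
  have xA: "supported ?A x" "supported ?A w" by (simp_all add: x_def w_def supported_uniform)
  then have sx: "supported C x" "supported C w" "supported C' x" "supported C' w"
    by (auto elim: supported_mono)
  have rx: "row_sums x = 1" "row_sums w = row_sums f"
    unfolding x_def w_def by (intro row_sums_uniform C(3))+
  have "\<forall>\<^sub>F \<epsilon> in at_right 0. \<forall>k c. 0 \<le> x $ k $ c - \<epsilon> * w $ k $ c"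
  proof (intro eventually_all_finite)
    fix k c
    show "\<forall>\<^sub>F \<epsilon> in at_right 0. 0 \<le> x $ k $ c - \<epsilon> * w $ k $ c"
    proof (cases "c \<in> ?A k")
      case True
      have "((\<lambda>\<epsilon>. x $ k $ c - \<epsilon> * w $ k $ c) \<longlongrightarrow> x $ k $ c - 0 * w $ k $ c) (at_right 0)"
        by (intro tendsto_intros)
      then have "\<forall>\<^sub>F \<epsilon> in at_right 0. 0 < x $ k $ c - \<epsilon> * w $ k $ c"
        by (rule order_tendstoD) (use uniform_one_pos[of c ?A k] True in \<open>simp add: x_def\<close>)
      then show ?thesis by eventually_elim simp
    next
      case False
      then show ?thesis using xA by (simp add: supported_def)
    qed
  qed
  then have "\<forall>\<^sub>F \<epsilon> in at_right 0. 0 < \<epsilon> \<and> (\<forall>k c. 0 \<le> x $ k $ c - \<epsilon> * w $ k $ c)"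
    using eventually_at_right_less[of 0] by eventually_elim simp
  then obtain \<epsilon> :: real where e: "0 < \<epsilon>" "\<And>k c. 0 \<le> x $ k $ c - \<epsilon> * w $ k $ c"
    using eventually_happens'[OF trivial_limit_at_right_real] by blast
  have nn: "0 \<le> (x + \<epsilon> *\<^sub>R (h - w)) $ k $ c" if "plan D h" for h D k c
  proof -
    have "0 \<le> \<epsilon> * h $ k $ c" using e(1) plan_nonneg[OF that] by simp
    then show ?thesis using e(2)[of k c] by (simp add: algebra_simps)
  qed
  have "x + \<epsilon> *\<^sub>R (f - w) \<in> unit_plans C"
    using nn[OF f(1)] sx f(1)
    by (auto simp: unit_plans_def plan_def sums_linear rx intro!: supported_add supported_diff supported_scaleR)
  moreover have "x + \<epsilon> *\<^sub>R (f' - w) \<in> unit_plans C'"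
    using nn[OF f(2)] sx f(2)
    by (auto simp: unit_plans_def plan_def sums_linear rx f(3) intro!: supported_add supported_diff supported_scaleR)
  moreover have "col_sums (x + \<epsilon> *\<^sub>R (f - w)) = col_sums (x + \<epsilon> *\<^sub>R (f' - w))"
    by (simp add: sums_linear f(4))
  ultimately have "x + \<epsilon> *\<^sub>R (f - w) = x + \<epsilon> *\<^sub>R (f' - w)"
    using unit_unique C by blast
  then show ?thesis using e(1) by simp
qed

text \<open>A short move from the interior point \<open>col_sums x\<close> of cell \<open>A\<close>
  ends in a cell that also contains this point. Uniqueness puts \<open>x\<close> on the type of that
  cell, which therefore contains \<open>A\<close>, and a difference quotient of plans in it yields
  \<open>w\<close>.\<close>

lemma star_direction:
  fixes \<mu> :: "real ^ 'n" and \<nu> :: "real ^ 'd"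
  assumes A: "A \<in> T"
    and tot: "(\<Sum>k\<in>UNIV. \<mu> $ k) = (\<Sum>c\<in>UNIV. \<nu> $ c)"
    and bd: "\<And>c. (\<And>k. c \<notin> A k) \<Longrightarrow> 0 \<le> \<nu> $ c"
  obtains D w where "D \<in> T" "\<And>k. A k \<subseteq> D k" "supported D w" "row_sums w = \<mu>" "col_sums w = \<nu>"
    "\<And>k c. c \<notin> A k \<Longrightarrow> 0 \<le> w $ k $ c"
proof -
  define x where "x = uniform_plan A 1"
  define w0 where "w0 = uniform_plan A \<mu>"
  have x: "x \<in> unit_plans A" unfolding x_def by (intro uniform_in_unit_plans nonempty A)
  have w0: "supported A w0" "row_sums w0 = \<mu>"
    unfolding w0_def by (intro supported_uniform row_sums_uniform nonempty A)+
  \<comment> \<open>\<open>w0\<close> absorbs the change \<open>\<mu>\<close> of the row sums,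
    leaving a direction of coordinate sum 0. Small moves along it stay in the dilated simplex:
    columns used by \<open>A\<close> have positive sums, and \<open>bd\<close> covers the
    others.\<close>
  define \<gamma> where "\<gamma> = \<nu> - col_sums w0"
  let ?p = "\<lambda>\<epsilon>. col_sums x + \<epsilon> *\<^sub>R \<gamma>"
  have "\<forall>\<^sub>F \<epsilon> in at_right 0. \<forall>c. 0 \<le> ?p \<epsilon> $ c"
  proof (intro eventually_all_finite)
    fix c
    show "\<forall>\<^sub>F \<epsilon> in at_right 0. 0 \<le> ?p \<epsilon> $ c"
    proof (cases "\<exists>k. c \<in> A k")
      case True
      then obtain k where k: "c \<in> A k" by blast
      have "0 < x $ k $ c" unfolding x_def by (rule uniform_one_pos) (rule k)
      also have "\<dots> \<le> col_sums x $ c" unfolding col_sums_nth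
        by (rule member_le_sum[where f = "\<lambda>k. x $ k $ c"]) (auto simp: x_def uniform_one_nonneg)
      finally have pos: "0 < col_sums x $ c" .
      have "((\<lambda>\<epsilon>. ?p \<epsilon> $ c) \<longlongrightarrow> (col_sums x + 0 *\<^sub>R \<gamma>) $ c) (at_right 0)"
        by (intro tendsto_intros)
      then have "\<forall>\<^sub>F \<epsilon> in at_right 0. 0 < ?p \<epsilon> $ c"
        by (rule order_tendstoD) (use pos in simp)
      then show ?thesis by eventually_elim simp
    next
      case False
      then have z: "x $ k $ c = 0" "w0 $ k $ c = 0" for k
        using w0(1) by (auto simp: supported_def x_def uniform_nth)
      then have "?p \<epsilon> $ c = \<epsilon> * \<nu> $ c" for \<epsilon> by (simp add: \<gamma>_def col_sums_nth)
      moreover have "0 \<le> \<nu> $ c" using bd False by blast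
      moreover have "\<forall>\<^sub>F \<epsilon> in at_right 0. (0::real) < \<epsilon>" by (rule eventually_at_right_less)
      ultimately show ?thesis by (auto elim: eventually_mono)
    qed
  qed
  moreover have "(\<Sum>c\<in>UNIV. ?p \<epsilon> $ c) = real CARD('n)" for \<epsilon>
  proof -
    have "(\<Sum>c\<in>UNIV. col_sums x $ c) = real CARD('n)" "(\<Sum>c\<in>UNIV. col_sums w0 $ c) = (\<Sum>k\<in>UNIV. \<mu> $ k)"
      using x w0 by (simp_all add: sum_row_sums[symmetric] unit_plans_def)
    then show ?thesis
      by (simp add: \<gamma>_def sum.distrib sum_distrib_left[symmetric] sum_subtractf tot)
  qed
  ultimately have "\<forall>\<^sub>F \<epsilon> in at_right 0. 0 < \<epsilon> \<and> (\<exists>D\<in>T. ?p \<epsilon> \<in> col_sums ` unit_plans D)"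
    using eventually_at_right_less[of 0]
    by (auto simp: cover elim: eventually_elim2)
  then have fr0: "\<exists>\<^sub>F \<epsilon> in at_right 0. \<exists>D\<in>T. 0 < \<epsilon> \<and> ?p \<epsilon> \<in> col_sums ` unit_plans D"
    by (intro eventually_frequently) (auto elim: eventually_mono)
  \<comment> \<open>As there are finitely many types, one of them serves arbitrarily small
    \<open>\<epsilon>\<close>; its closed cell then contains the limit
    \<open>col_sums x\<close>.\<close>
  obtain D where D: "D \<in> T"
    and fr: "\<exists>\<^sub>F \<epsilon> in at_right 0. 0 < \<epsilon> \<and> ?p \<epsilon> \<in> col_sums ` unit_plans D"
    using frequently_bex_finite[OF finite fr0] by blast
  have cl: "closed (col_sums ` unit_plans D)"
    by (intro compact_imp_closed compact_continuous_image compact_unit_plans continuous_intros)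
  have "col_sums x \<in> col_sums ` unit_plans D"
  proof (rule ccontr)
    assume "col_sums x \<notin> col_sums ` unit_plans D"
    moreover have "(?p \<longlongrightarrow> col_sums x + 0 *\<^sub>R \<gamma>) (at_right 0)" by (intro tendsto_intros)
    ultimately have "\<forall>\<^sub>F \<epsilon> in at_right 0. ?p \<epsilon> \<in> - (col_sums ` unit_plans D)"
      using cl by (intro topological_tendstoD) auto
    then have "\<not> (\<exists>\<^sub>F \<epsilon> in at_right 0. 0 < \<epsilon> \<and> ?p \<epsilon> \<in> col_sums ` unit_plans D)"
      unfolding frequently_def by (auto elim: eventually_mono)
    then show False using fr by blast
  qed
  then have xD: "x \<in> unit_plans D" using unit_unique[OF A D x] by (metis imageE)
  obtain \<epsilon> y where e: "0 < \<epsilon>" "y \<in> unit_plans D" "col_sums y = ?p \<epsilon>"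
    using frequently_ex[OF fr] by (metis imageE)
  have AD: "A k \<subseteq> D k" for k
  proof
    fix c assume "c \<in> A k"
    then have "x $ k $ c \<noteq> 0" unfolding x_def using uniform_one_pos[of c A k] by auto
    then show "c \<in> D k" using xD by (auto simp: unit_plans_def plan_def supported_def)
  qed
  \<comment> \<open>Adding \<open>w0\<close> restores the row sums \<open>\<mu>\<close> and the part
    of \<open>\<nu>\<close> removed in \<open>\<gamma>\<close>. Off \<open>A\<close> both
    \<open>x\<close> and \<open>w0\<close> vanish, so only nonnegative entries of \<open>y\<close>
    remain.\<close>
  define w where "w = (1 / \<epsilon>) *\<^sub>R (y - x) + w0"
  show thesis
  proof (rule that[OF D AD])
    show "supported D w" unfolding w_def
      using e(2) xD w0(1) AD
      by (intro supported_add supported_scaleR supported_diff supported_mono[OF w0(1)])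
        (auto simp: unit_plans_def plan_def)
    show "row_sums w = \<mu>" using e x w0 by (simp add: w_def sums_linear unit_plans_def)
    show "col_sums w = \<nu>" using e by (simp add: w_def sums_linear \<gamma>_def)
    show "0 \<le> w $ k $ c" if "c \<notin> A k" for k c
      using that e w0(1) by (simp add: w_def supported_def x_def uniform_nth unit_plans_def plan_def)
  qed
qed

definition over :: "real ^ 'n \<Rightarrow> real ^ 'd \<Rightarrow> ('n \<Rightarrow> 'd set) \<Rightarrow> (real ^ 'd ^ 'n) set" where
  "over \<mu> \<nu> C = {f. plan C f \<and> row_sums f = \<mu> \<and> col_sums f = \<nu>}"

text \<open>The row sums enter only through their positivity: it makes the support of
  \<open>f\<close> a type by downward closure. The direction found for this support is nonnegative
  wherever \<open>f\<close> vanishes, so a short move keeps all entries nonnegative.\<close>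

lemma extend_plan:
  assumes C: "C \<in> T" and f: "f \<in> over \<mu> \<nu> C" and pos: "\<And>k. 0 < \<mu> $ k"
    and tot: "(\<Sum>k\<in>UNIV. \<mu>' $ k) = (\<Sum>c\<in>UNIV. \<nu>' $ c)"
    and bd: "\<And>c. \<nu> $ c = 0 \<Longrightarrow> 0 \<le> \<nu>' $ c"
  obtains D w where "D \<in> T" "supported D w" "row_sums w = \<mu>'" "col_sums w = \<nu>'"
    "\<forall>\<^sub>F \<epsilon> in at_right 0. f + \<epsilon> *\<^sub>R w \<in> over (\<mu> + \<epsilon> *\<^sub>R \<mu>') (\<nu> + \<epsilon> *\<^sub>R \<nu>') D"
proof -
  define A where "A = (\<lambda>k. {c. 0 < f $ k $ c})"
  have nn: "0 \<le> f $ k $ c" for k c using f by (simp add: over_def plan_def)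
  have AC: "A k \<subseteq> C k" for k using f by (fastforce simp: A_def over_def plan_def supported_def)
  have Ane: "A k \<noteq> {}" for k
  proof
    assume "A k = {}"
    then have "f $ k $ c = 0" for c using nn[of k c] by (auto simp: A_def less_le)
    then have "row_sums f $ k = 0" by (simp add: row_sums_nth)
    then show False using f pos[of k] by (simp add: over_def)
  qed
  have A: "A \<in> T" using downward[OF C AC Ane] .
  have bd': "0 \<le> \<nu>' $ c" if "\<And>k. c \<notin> A k" for c
  proof (rule bd)
    have "f $ k $ c = 0" for k using that[of k] nn[of k c] by (simp add: A_def)
    then have "col_sums f $ c = 0" by (simp add: col_sums_nth)
    then show "\<nu> $ c = 0" using f by (simp add: over_def)
  qed
  obtain D w where D: "D \<in> T" "\<And>k. A k \<subseteq> D k" "supported D w" "row_sums w = \<mu>'" "col_sums w = \<nu>'"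
    "\<And>k c. c \<notin> A k \<Longrightarrow> 0 \<le> w $ k $ c"
    using star_direction[OF A tot bd'] by metis
  have "\<forall>\<^sub>F \<epsilon> in at_right 0. \<forall>k c. 0 \<le> f $ k $ c + \<epsilon> * w $ k $ c"
  proof (intro eventually_all_finite)
    fix k c
    show "\<forall>\<^sub>F \<epsilon> in at_right 0. 0 \<le> f $ k $ c + \<epsilon> * w $ k $ c"
    proof (cases "c \<in> A k")
      case True
      have "((\<lambda>\<epsilon>. f $ k $ c + \<epsilon> * w $ k $ c) \<longlongrightarrow> f $ k $ c + 0 * w $ k $ c) (at_right 0)"
        by (intro tendsto_intros)
      then have "\<forall>\<^sub>F \<epsilon> in at_right 0. 0 < f $ k $ c + \<epsilon> * w $ k $ c"
        by (rule order_tendstoD) (use True in \<open>simp add: A_def\<close>)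
      then show ?thesis by eventually_elim simp
    next
      case False
      have "\<forall>\<^sub>F \<epsilon> in at_right 0. (0::real) < \<epsilon>" by (rule eventually_at_right_less)
      then show ?thesis by eventually_elim (simp add: nn D(6)[OF False])
    qed
  qed
  moreover have "supported D f" 
    using D(2) nn by (fastforce simp: supported_def A_def subset_iff less_le)
  ultimately have "\<forall>\<^sub>F \<epsilon> in at_right 0. f + \<epsilon> *\<^sub>R w \<in> over (\<mu> + \<epsilon> *\<^sub>R \<mu>') (\<nu> + \<epsilon> *\<^sub>R \<nu>') D"
  proof (elim eventually_mono)
    fix \<epsilon> assume "\<forall>k c. 0 \<le> f $ k $ c + \<epsilon> * w $ k $ c"
    then show "f + \<epsilon> *\<^sub>R w \<in> over (\<mu> + \<epsilon> *\<^sub>R \<mu>') (\<nu> + \<epsilon> *\<^sub>R \<nu>') D"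
      using \<open>supported D f\<close> f D by (simp add: over_def plan_def sums_linear supported_add supported_scaleR)
  qed
  with D show thesis by (intro that)
qed

end

section \<open>Continuation of plans along segments of row and column sums\<close>

text \<open>By compactness \<open>S\<close> has a largest element, and nothing in \<open>S\<close>
  lies above it, so it cannot be below 1.\<close>

lemma continuation:
  fixes S :: "real set"
  assumes "compact S" "S \<subseteq> {0..1}" "0 \<in> S" "\<And>s. s \<in> S \<Longrightarrow> s < 1 \<Longrightarrow> \<exists>t\<in>S. s < t"
  shows "1 \<in> S"
proof -
  obtain s where s: "s \<in> S" "\<And>t. t \<in> S \<Longrightarrow> t \<le> s"
    using compact_attains_sup[of S] assms by blast
  then have "\<not> s < 1" using assms(4)[of s] by force
  then show ?thesis using s(1) assms(2) by force
qed

context plan_complex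
begin

text \<open>Projecting to \<open>t\<close> yields compact sets of parameters, as
  \<open>continuation\<close> requires. Boundedness holds because the total mass is controlled by
  the row sums.\<close>

lemma compact_over_segment:
  fixes \<mu> \<mu>' :: "real ^ 'n" and \<nu> \<nu>' :: "real ^ 'd"
  shows "compact {(t, f). t \<in> {0..1} \<and> f \<in> over (\<mu> + t *\<^sub>R \<mu>') (\<nu> + t *\<^sub>R \<nu>') C}"
proof (rule compact_eq_bounded_closed[THEN iffD2], rule conjI)
  let ?S = "{(t, f). t \<in> {0..1} \<and> f \<in> over (\<mu> + t *\<^sub>R \<mu>') (\<nu> + t *\<^sub>R \<nu>') C}"
  let ?b = "(\<Sum>k\<in>UNIV. \<bar>\<mu> $ k\<bar> + \<bar>\<mu>' $ k\<bar>)"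
  have "?S \<subseteq> {0..1} \<times> cball 0 ?b"
  proof clarsimp
    fix t :: real and f assume t: "0 \<le> t" "t \<le> 1" and f: "f \<in> over (\<mu> + t *\<^sub>R \<mu>') (\<nu> + t *\<^sub>R \<nu>') C"
    have "norm f \<le> (\<Sum>k\<in>UNIV. \<mu> $ k + t * \<mu>' $ k)"
      using plan_norm_bound[of C f] f by (simp add: over_def)
    also have "\<dots> \<le> ?b"
    proof (intro sum_mono add_mono abs_ge_self)
      fix k
      have "t * \<mu>' $ k \<le> t * \<bar>\<mu>' $ k\<bar>" using t by (intro mult_left_mono) auto
      also have "\<dots> \<le> 1 * \<bar>\<mu>' $ k\<bar>" using t by (intro mult_right_mono) auto
      finally show "t * \<mu>' $ k \<le> \<bar>\<mu>' $ k\<bar>" by simp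
    qed
    finally show "norm f \<le> ?b" .
  qed
  then show "bounded ?S" by (rule bounded_subset[rotated]) (intro bounded_Times bounded_cball, simp)
  have "closed {p. plan C (snd p)}" 
    using closed_vimage[OF closed_plan[of C], of snd] by (simp add: vimage_def continuous_on_snd)
  then have "closed (({p. 0 \<le> fst p} \<inter> {p. fst p \<le> 1}) \<inter> {p. plan C (snd p)} \<inter>
      ({p. row_sums (snd p) = \<mu> + fst p *\<^sub>R \<mu>'} \<inter> {p. col_sums (snd p) = \<nu> + fst p *\<^sub>R \<nu>'}))"
    by (intro closed_Int closed_Collect_le closed_Collect_eq continuous_intros)
  also have "\<dots> = ?S" by (auto simp: over_def)
  finally show "closed ?S" .
qed

text \<open>The hypotheses of \<open>extend_plan\<close> hold by convexity: row sums positive at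
  both ends are positive in between, and a column sum that is 0 at \<open>s < 1\<close> and
  nonnegative at the end cannot be decreasing.\<close>

lemma segment_step:
  fixes \<mu> \<mu>' :: "real ^ 'n" and \<nu> \<nu>' :: "real ^ 'd"
  assumes C: "C \<in> T" and s: "0 \<le> s" "s < 1" and f: "f \<in> over (\<mu> + s *\<^sub>R \<mu>') (\<nu> + s *\<^sub>R \<nu>') C"
    and pos: "\<And>k. 0 < \<mu> $ k" "\<And>k. 0 < (\<mu> + \<mu>') $ k"
    and tot: "(\<Sum>k\<in>UNIV. \<mu>' $ k) = (\<Sum>c\<in>UNIV. \<nu>' $ c)"
    and nn: "\<And>c. 0 \<le> (\<nu> + \<nu>') $ c"
  obtains D w where "D \<in> T" "supported D w" "row_sums w = \<mu>'" "col_sums w = \<nu>'"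
    "\<forall>\<^sub>F \<epsilon> in at_right 0. f + \<epsilon> *\<^sub>R w \<in> over (\<mu> + (s + \<epsilon>) *\<^sub>R \<mu>') (\<nu> + (s + \<epsilon>) *\<^sub>R \<nu>') D"
proof -
  have p: "0 < (\<mu> + s *\<^sub>R \<mu>') $ k" for k
  proof -
    have "0 < (1 - s) * \<mu> $ k" using s pos by simp
    moreover have "0 \<le> s * (\<mu> $ k + \<mu>' $ k)" using s pos(2)[of k] by simp
    ultimately show ?thesis by (simp add: algebra_simps)
  qed
  have b: "0 \<le> \<nu>' $ c" if "(\<nu> + s *\<^sub>R \<nu>') $ c = 0" for c
  proof -
    have "0 \<le> (\<nu> + \<nu>') $ c - (\<nu> + s *\<^sub>R \<nu>') $ c" using nn[of c] that by simp
    also have "\<dots> = (1 - s) * \<nu>' $ c" by (simp add: algebra_simps)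
    finally show ?thesis using s by (simp add: zero_le_mult_iff)
  qed
  obtain D w where "D \<in> T" "supported D w" "row_sums w = \<mu>'" "col_sums w = \<nu>'"
    "\<forall>\<^sub>F \<epsilon> in at_right 0. f + \<epsilon> *\<^sub>R w \<in> over (\<mu> + s *\<^sub>R \<mu>' + \<epsilon> *\<^sub>R \<mu>') (\<nu> + s *\<^sub>R \<nu>' + \<epsilon> *\<^sub>R \<nu>') D"
    using extend_plan[OF C f p tot b] by blast
  then show thesis by (intro that[of D w]) (simp_all add: scaleR_add_left add.assoc)
qed

text \<open>Two distinct plans are carried to unit row sums, where \<open>unit_unique\<close> makes
  them equal. They remain distinct on the way, because types disjoint in a row of positive sum
  cannot carry the same plan.\<close>

lemma plan_unique:
  fixes \<mu> :: "real ^ 'n"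
  assumes C: "C \<in> T" "C' \<in> T" and f: "f \<in> over \<mu> \<nu> C" "f' \<in> over \<mu> \<nu> C'" and pos: "\<And>k. 0 < \<mu> $ k"
  shows "f = f'"
proof (rule ccontr)
  assume neq: "f \<noteq> f'"
  define s where "s = (\<Sum>k\<in>UNIV. \<mu> $ k)"
  have s: "0 < s" unfolding s_def using pos by (intro sum_pos) auto
  have s': "(\<Sum>c\<in>UNIV. \<nu> $ c) = s" using f sum_row_sums[of f] by (simp add: over_def s_def)
  have \<nu>nn: "0 \<le> \<nu> $ c" for c
    using f(1) by (auto simp: over_def col_sums_nth plan_def intro!: sum_nonneg)
  \<comment> \<open>Scaling the columns by \<open>r\<close> brings their total to
    \<open>CARD('n)\<close>, the total of unit row sums.\<close>
  define r where "r = real CARD('n) / s"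
  define \<mu>' where "\<mu>' = 1 - \<mu>"
  define \<nu>' where "\<nu>' = (r - 1) *\<^sub>R \<nu>"
  have pos': "0 < (\<mu> + \<mu>') $ k" for k by (simp add: \<mu>'_def)
  have tot: "(\<Sum>k\<in>UNIV. \<mu>' $ k) = (\<Sum>c\<in>UNIV. \<nu>' $ c)"
  proof -
    have "(\<Sum>c\<in>UNIV. \<nu>' $ c) = (r - 1) * s" by (simp add: \<nu>'_def sum_distrib_left[symmetric] s')
    then show ?thesis
      using s by (simp add: \<mu>'_def sum_subtractf r_def s_def[symmetric] left_diff_distrib)
  qed
  have nn: "0 \<le> (\<nu> + \<nu>') $ c" for c
    using s \<nu>nn by (simp add: \<nu>'_def r_def left_diff_distrib)
  \<comment> \<open>By \<open>eq_if_common_cell\<close>, distinct plans live on types that are disjoint in some row, a closed condition.\<close>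
  define Q where "Q = {(C, C'). C \<in> T \<and> C' \<in> T \<and> (\<exists>k. C k \<inter> C' k = {})}"
  define X where "X = (\<lambda>C. fst ` {(t, f). t \<in> {0..1} \<and> f \<in> over (\<mu> + t *\<^sub>R \<mu>') (\<nu> + t *\<^sub>R \<nu>') C})"
  have Xiff: "t \<in> X C \<longleftrightarrow> t \<in> {0..1} \<and> (\<exists>f. f \<in> over (\<mu> + t *\<^sub>R \<mu>') (\<nu> + t *\<^sub>R \<nu>') C)" for t C
    by (auto simp: X_def image_iff)
  have X: "compact (X C)" for C
    unfolding X_def by (intro compact_continuous_image compact_over_segment continuous_intros)
  have Qne: "(C, C') \<in> Q" if "C \<in> T" "C' \<in> T" "g \<in> over \<mu> \<nu> C" "g' \<in> over \<mu> \<nu> C'" "g \<noteq> g'"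
    for C C' g g' and \<mu> :: "real ^ 'n" and \<nu> :: "real ^ 'd"
  proof (rule ccontr)
    assume "(C, C') \<notin> Q"
    then have "C k \<inter> C' k \<noteq> {}" for k using that by (auto simp: Q_def)
    then have "g = g'" using that by (intro eq_if_common_cell[of C C']) (auto simp: over_def)
    then show False using that by simp
  qed
  let ?S = "\<Union>q\<in>Q. X (fst q) \<inter> X (snd q)"
  have "1 \<in> ?S"
  proof (rule continuation)
    show "compact ?S"
    proof (intro compact_UN compact_Int X)
      show "finite Q" by simp
    qed
    show "?S \<subseteq> {0..1}" by (auto simp: Xiff)
    show "0 \<in> ?S"
    proof (rule UN_I[OF Qne[OF C f neq]])
      show "0 \<in> X (fst (C, C')) \<inter> X (snd (C, C'))" using f by (auto simp: Xiff)
    qed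
    fix t assume "t \<in> ?S" and t1: "t < 1"
    then obtain C C' g g' where t0: "0 \<le> t" and Q: "(C, C') \<in> Q"
      and g: "g \<in> over (\<mu> + t *\<^sub>R \<mu>') (\<nu> + t *\<^sub>R \<nu>') C" "g' \<in> over (\<mu> + t *\<^sub>R \<mu>') (\<nu> + t *\<^sub>R \<nu>') C'"
      by (auto simp: Xiff)
    from Q have T: "C \<in> T" "C' \<in> T" by (auto simp: Q_def)
    obtain k where k: "C k \<inter> C' k = {}" using Q by (auto simp: Q_def)
    have "0 < (\<mu> + t *\<^sub>R \<mu>') $ k"
    proof -
      have "0 < (1 - t) * \<mu> $ k" using t1 pos by simp
      then show ?thesis using t0 by (simp add: \<mu>'_def algebra_simps)
    qed
    have "g \<noteq> g'"
    proof
      assume eq: "g = g'"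
      have "g $ k $ c = 0" for c
        using g k eq by (cases "c \<in> C k") (auto simp: over_def plan_def supported_def)
      then have "row_sums g $ k = 0" by (simp add: row_sums_nth)
      then show False using g \<open>0 < (\<mu> + t *\<^sub>R \<mu>') $ k\<close> by (simp add: over_def)
    qed
    obtain D w where D: "D \<in> T"
      "\<forall>\<^sub>F \<epsilon> in at_right 0. g + \<epsilon> *\<^sub>R w \<in> over (\<mu> + (t + \<epsilon>) *\<^sub>R \<mu>') (\<nu> + (t + \<epsilon>) *\<^sub>R \<nu>') D"
      using segment_step[OF T(1) t0 t1 g(1) pos pos' tot nn] by blast
    obtain D' w' where D': "D' \<in> T"
      "\<forall>\<^sub>F \<epsilon> in at_right 0. g' + \<epsilon> *\<^sub>R w' \<in> over (\<mu> + (t + \<epsilon>) *\<^sub>R \<mu>') (\<nu> + (t + \<epsilon>) *\<^sub>R \<nu>') D'"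
      using segment_step[OF T(2) t0 t1 g(2) pos pos' tot nn] by blast
    \<comment> \<open>Both plans move a short step; their difference stays nonzero by continuity, so
      the new types again form a pair in \<open>Q\<close>.\<close>
    have "((\<lambda>\<epsilon>. (g + \<epsilon> *\<^sub>R w) - (g' + \<epsilon> *\<^sub>R w')) \<longlongrightarrow> (g + 0 *\<^sub>R w) - (g' + 0 *\<^sub>R w')) (at_right 0)"
      by (intro tendsto_intros)
    then have "\<forall>\<^sub>F \<epsilon> in at_right 0. (g + \<epsilon> *\<^sub>R w) - (g' + \<epsilon> *\<^sub>R w') \<noteq> 0"
      by (rule tendsto_imp_eventually_ne) (use \<open>g \<noteq> g'\<close> in simp)
    moreover have "\<forall>\<^sub>F \<epsilon> in at_right 0. 0 < \<epsilon> \<and> \<epsilon> < 1 - t"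
      using eventually_at_right_real[of 0 "1 - t"] t1 by simp
    ultimately have "\<forall>\<^sub>F \<epsilon> in at_right 0. t + \<epsilon> \<in> ?S \<and> t < t + \<epsilon>"
      using D(2) D'(2)
    proof eventually_elim
      case (elim \<epsilon>)
      have "(D, D') \<in> Q" using Qne[OF D(1) D'(1) elim(3,4)] elim(1) by auto
      moreover have "t + \<epsilon> \<in> X D \<inter> X D'" using elim t0 by (auto simp: Xiff)
      ultimately have "t + \<epsilon> \<in> ?S" by force
      then show ?case using elim(2) by auto
    qed
    then show "\<exists>u\<in>?S. t < u" using eventually_happens'[OF trivial_limit_at_right_real] by blast
  qed
  then obtain C C' g g' where Q: "(C, C') \<in> Q"
    and g: "g \<in> over (\<mu> + \<mu>') (\<nu> + \<nu>') C" "g' \<in> over (\<mu> + \<mu>') (\<nu> + \<nu>') C'"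
    by (auto simp: Xiff)
  from Q obtain k where T: "C \<in> T" "C' \<in> T" and k: "C k \<inter> C' k = {}" by (auto simp: Q_def)
  have eq: "g = g'" using g by (intro unit_unique[OF T]) (auto simp: unit_plans_def over_def \<mu>'_def)
  have "g $ k $ c = 0" for c
    using g k eq by (cases "c \<in> C k") (auto simp: over_def plan_def supported_def)
  then have "row_sums g $ k = 0" by (simp add: row_sums_nth)
  then show False using g pos'[of k] by (simp add: over_def)
qed

text \<open>Continuation with a speed limit: every step follows a direction whose entries are at
  most \<open>b\<close> in absolute value, so the displacement at time \<open>t\<close> is at most
  \<open>t * b\<close>. Being a closed condition, this bound can be built into the sets
  \<open>X\<close>.\<close>

lemma lift_plan:
  fixes \<mu> \<mu>' :: "real ^ 'n" and \<nu> \<nu>' :: "real ^ 'd"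
  assumes L: "0 \<le> L" "\<forall>A\<in>T. \<forall>g k c. supported A g \<longrightarrow>
      \<bar>g $ k $ c\<bar> \<le> L * (norm (row_sums g) + norm (col_sums g))"
    and C: "C \<in> T" and f: "f \<in> over \<mu> \<nu> C"
    and pos: "\<And>k. 0 < \<mu> $ k" "\<And>k. 0 < (\<mu> + \<mu>') $ k"
    and tot: "(\<Sum>k\<in>UNIV. \<mu>' $ k) = (\<Sum>c\<in>UNIV. \<nu>' $ c)"
    and nn: "\<And>c. 0 \<le> (\<nu> + \<nu>') $ c"
  obtains D g where "D \<in> T" "g \<in> over (\<mu> + \<mu>') (\<nu> + \<nu>') D"
    "\<And>k c. \<bar>g $ k $ c - f $ k $ c\<bar> \<le> L * (norm \<mu>' + norm \<nu>')"
proof -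
  define b where "b = L * (norm \<mu>' + norm \<nu>')"
  define X where "X = (\<lambda>C. fst ` ({(t, f). t \<in> {0..1} \<and> f \<in> over (\<mu> + t *\<^sub>R \<mu>') (\<nu> + t *\<^sub>R \<nu>') C}
    \<inter> {p. \<forall>k c. \<bar>snd p $ k $ c - f $ k $ c\<bar> \<le> fst p * b}))"
  have Xiff: "t \<in> X C \<longleftrightarrow> t \<in> {0..1} \<and> (\<exists>g. g \<in> over (\<mu> + t *\<^sub>R \<mu>') (\<nu> + t *\<^sub>R \<nu>') C \<and>
      (\<forall>k c. \<bar>g $ k $ c - f $ k $ c\<bar> \<le> t * b))" for t C
  proof
    assume "t \<in> X C"
    then show "t \<in> {0..1} \<and> (\<exists>g. g \<in> over (\<mu> + t *\<^sub>R \<mu>') (\<nu> + t *\<^sub>R \<nu>') C \<and>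
      (\<forall>k c. \<bar>g $ k $ c - f $ k $ c\<bar> \<le> t * b))"
      by (auto simp: X_def)
  next
    assume "t \<in> {0..1} \<and> (\<exists>g. g \<in> over (\<mu> + t *\<^sub>R \<mu>') (\<nu> + t *\<^sub>R \<nu>') C \<and>
      (\<forall>k c. \<bar>g $ k $ c - f $ k $ c\<bar> \<le> t * b))"
    then obtain g where "t \<in> {0..1}" "g \<in> over (\<mu> + t *\<^sub>R \<mu>') (\<nu> + t *\<^sub>R \<nu>') C"
      "\<forall>k c. \<bar>g $ k $ c - f $ k $ c\<bar> \<le> t * b" by blast
    then show "t \<in> X C" unfolding X_def by (intro image_eqI[of _ _ "(t, g)"]) auto
  qed
  have X: "compact (X C)" for C
    unfolding X_def
    by (intro compact_continuous_image compact_Int_closed compact_over_segment continuous_intros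
        closed_Collect_all closed_Collect_le)
  have "1 \<in> (\<Union>C\<in>T. X C)"
  proof (rule continuation)
    show "compact (\<Union>C\<in>T. X C)" by (intro compact_UN X) simp
    show "(\<Union>C\<in>T. X C) \<subseteq> {0..1}" by (auto simp: Xiff)
    show "0 \<in> (\<Union>C\<in>T. X C)" using C f by (auto simp: Xiff)
    fix t assume "t \<in> (\<Union>C\<in>T. X C)" and t1: "t < 1"
    then obtain C g where t0: "0 \<le> t" and T: "C \<in> T"
      and g: "g \<in> over (\<mu> + t *\<^sub>R \<mu>') (\<nu> + t *\<^sub>R \<nu>') C" "\<And>k c. \<bar>g $ k $ c - f $ k $ c\<bar> \<le> t * b"
      by (auto simp: Xiff)
    obtain D w where D: "D \<in> T" "supported D w" "row_sums w = \<mu>'" "col_sums w = \<nu>'"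
      "\<forall>\<^sub>F \<epsilon> in at_right 0. g + \<epsilon> *\<^sub>R w \<in> over (\<mu> + (t + \<epsilon>) *\<^sub>R \<mu>') (\<nu> + (t + \<epsilon>) *\<^sub>R \<nu>') D"
      using segment_step[OF T t0 t1 g(1) pos tot nn] by blast
    have w: "\<bar>w $ k $ c\<bar> \<le> b" for k c using L(2)[rule_format, OF D(1,2), of k c] D by (simp add: b_def)
    have "\<forall>\<^sub>F \<epsilon> in at_right 0. 0 < \<epsilon> \<and> \<epsilon> < 1 - t"
      using eventually_at_right_real[of 0 "1 - t"] t1 by simp
    then have "\<forall>\<^sub>F \<epsilon> in at_right 0. t + \<epsilon> \<in> (\<Union>C\<in>T. X C) \<and> t < t + \<epsilon>"
      using D(5)
    proof eventually_elim
      case (elim \<epsilon>)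
      have "\<bar>(g + \<epsilon> *\<^sub>R w) $ k $ c - f $ k $ c\<bar> \<le> (t + \<epsilon>) * b" for k c
      proof -
        have "\<bar>(g + \<epsilon> *\<^sub>R w) $ k $ c - f $ k $ c\<bar> \<le> \<bar>g $ k $ c - f $ k $ c\<bar> + \<bar>\<epsilon> * w $ k $ c\<bar>"
          by simp
        also have "\<bar>\<epsilon> * w $ k $ c\<bar> \<le> \<epsilon> * b" using elim w[of k c] by (simp add: abs_mult)
        finally show ?thesis using g(2)[of k c] by (simp add: algebra_simps)
      qed
      then have "t + \<epsilon> \<in> X D" using elim t0 by (auto simp: Xiff)
      then show ?case using elim D by auto
    qed
    then show "\<exists>u\<in>(\<Union>C\<in>T. X C). t < u" using eventually_happens'[OF trivial_limit_at_right_real] by blast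
  qed
  then obtain D g where "D \<in> T" "g \<in> over (\<mu> + \<mu>') (\<nu> + \<nu>') D"
    "\<And>k c. \<bar>g $ k $ c - f $ k $ c\<bar> \<le> b"
    by (auto simp: Xiff)
  then show thesis using that unfolding b_def by blast
qed

text \<open>Adding \<open>\<epsilon>\<close> times a unit plan makes the row sums positive; then let \<open>\<epsilon> \<rightarrow> 0\<close>.\<close>

theorem comparable:
  assumes T: "A \<in> T" "B \<in> T" and g: "plan A g" and h: "plan B h"
    and eq: "row_sums g = row_sums h" "col_sums g = col_sums h"
  shows "g = h"
proof -
  obtain L where L: "0 \<le> L" "\<forall>A\<in>T. \<forall>g k c. supported A g \<longrightarrow>
      \<bar>g $ k $ c\<bar> \<le> L * (norm (row_sums g) + norm (col_sums g))"
    using supported_entry_bound by blast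
  define x where "x = uniform_plan A 1"
  define y where "y = uniform_plan B 1"
  have x: "row_sums x = 1" "plan A x" and y: "row_sums y = 1" "plan B y"
    using uniform_in_unit_plans[of A] uniform_in_unit_plans[of B] nonempty T
    by (auto simp: x_def y_def unit_plans_def)
  \<comment> \<open>The summand 1 accounts for the entries of \<open>y - x\<close>, which are at
    most 1 in absolute value.\<close>
  define b where "b = L * norm (col_sums y - col_sums x) + 1"
  have main: "\<bar>h $ k $ c - g $ k $ c\<bar> \<le> \<epsilon> * b" if e: "0 < \<epsilon>" for \<epsilon> k c
  proof -
    let ?\<mu> = "row_sums g + \<epsilon> *\<^sub>R 1" and ?\<nu> = "col_sums g + \<epsilon> *\<^sub>R col_sums x"
      and ?\<nu>' = "\<epsilon> *\<^sub>R (col_sums y - col_sums x)"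
    have G: "g + \<epsilon> *\<^sub>R x \<in> over ?\<mu> ?\<nu> A"
      using g x e by (simp add: over_def plan_def supported_add supported_scaleR sums_linear)
    have H: "h + \<epsilon> *\<^sub>R y \<in> over (?\<mu> + 0) (?\<nu> + ?\<nu>') B"
      using h y e eq by (simp add: over_def plan_def supported_add supported_scaleR sums_linear algebra_simps)
    have pos: "0 < ?\<mu> $ k" for k
    proof -
      have "0 \<le> row_sums g $ k" using g by (auto simp: row_sums_nth plan_def intro!: sum_nonneg)
      then show ?thesis using e by simp
    qed
    then have pos0: "0 < (?\<mu> + 0) $ k" for k by simp
    have nn: "0 \<le> (?\<nu> + ?\<nu>') $ c" for c
    proof -
      have "0 \<le> col_sums (h + \<epsilon> *\<^sub>R y) $ c" 
        unfolding col_sums_nth using H by (intro sum_nonneg) (auto simp: over_def plan_def)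
      moreover have "col_sums (h + \<epsilon> *\<^sub>R y) = ?\<nu> + ?\<nu>'" using H by (simp only: over_def mem_Collect_eq)
      ultimately show ?thesis by (simp only:)
    qed
    have tot: "(\<Sum>k\<in>UNIV. (0 :: real ^ 'n) $ k) = (\<Sum>c\<in>UNIV. ?\<nu>' $ c)"
      using sum_row_sums[of x] sum_row_sums[of y]
      by (simp add: sum_distrib_left[symmetric] sum_subtractf x y)
    \<comment> \<open>Only the column sums are moved, which gives a plan close to
      \<open>g + \<epsilon> *\<^sub>R x\<close>. Having the sums of
      \<open>h + \<epsilon> *\<^sub>R y\<close>, it equals that plan by
      \<open>plan_unique\<close>.\<close>
    have "\<exists>D\<in>T. \<exists>f\<in>over (?\<mu> + 0) (?\<nu> + ?\<nu>') D. \<forall>k c.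
        \<bar>f $ k $ c - (g + \<epsilon> *\<^sub>R x) $ k $ c\<bar> \<le> L * (norm (0 :: real ^ 'n) + norm ?\<nu>')"
      by (rule lift_plan[OF L T(1) G pos pos0 tot nn]) (intro bexI allI)
    then obtain D f where D: "D \<in> T" "f \<in> over (?\<mu> + 0) (?\<nu> + ?\<nu>') D"
      and f: "\<And>k c. \<bar>f $ k $ c - (g + \<epsilon> *\<^sub>R x) $ k $ c\<bar> \<le> L * (norm (0 :: real ^ 'n) + norm ?\<nu>')"
      by blast
    have "f = h + \<epsilon> *\<^sub>R y"
      by (rule plan_unique[OF D(1) T(2) D(2) H]) (use pos in simp)
    moreover have nrm: "norm ?\<nu>' = \<epsilon> * norm (col_sums y - col_sums x)" using e by simp
    ultimately have "\<bar>(h $ k $ c - g $ k $ c) + \<epsilon> * (y $ k $ c - x $ k $ c)\<bar>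
        \<le> \<epsilon> * (L * norm (col_sums y - col_sums x))"
      using f[of k c, unfolded nrm] by (simp add: algebra_simps)
    moreover have "\<bar>\<epsilon> * (y $ k $ c - x $ k $ c)\<bar> \<le> \<epsilon> * 1"
    proof -
      have "\<bar>y $ k $ c - x $ k $ c\<bar> \<le> 1"
        using uniform_one_le[of A k c] uniform_one_le[of B k c] uniform_one_nonneg[of A k c]
          uniform_one_nonneg[of B k c] by (simp add: x_def y_def)
      then show ?thesis using e by (simp add: abs_mult)
    qed
    ultimately show ?thesis by (simp add: b_def distrib_left)
  qed
  have "h $ k $ c = g $ k $ c" for k c
  proof -
    have "((\<lambda>\<epsilon>. \<epsilon> * b) \<longlongrightarrow> 0 * b) (at_right 0)" by (intro tendsto_intros)
    moreover have "\<forall>\<^sub>F \<epsilon> in at_right 0. \<bar>h $ k $ c - g $ k $ c\<bar> \<le> \<epsilon> * b"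
      using eventually_at_right_less[of 0] by eventually_elim (rule main)
    ultimately have "\<bar>h $ k $ c - g $ k $ c\<bar> \<le> 0 * b"
      by (intro tendsto_lowerbound[OF _ _ trivial_limit_at_right_real])
    then show ?thesis by simp
  qed
  then show ?thesis by (simp add: vec_eq_iff)
qed

end

section \<open>Elimination\<close>

text \<open>Choose \<open>v\<close> in \<open>V\<close> with the fewest reachable vertices. A vertex
  of \<open>V\<close> reachable from \<open>v\<close> reaches a subset of these, hence all of them,
  \<open>v\<close> included.\<close>

lemma finite_preorder_maximal:
  fixes r :: "('a::finite \<times> 'a) set"
  assumes "V \<noteq> {}"
  obtains v where "v \<in> V" "\<And>u. u \<in> V \<Longrightarrow> (v, u) \<in> r\<^sup>* \<Longrightarrow> (u, v) \<in> r\<^sup>*"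
proof -
  obtain v where v: "v \<in> V" "\<And>u. u \<in> V \<Longrightarrow> card (r\<^sup>* `` {v}) \<le> card (r\<^sup>* `` {u})"
    using assms ex_has_least_nat[of "\<lambda>v. v \<in> V" _ "\<lambda>v. card (r\<^sup>* `` {v})"] by blast
  show thesis
  proof (rule that[OF v(1)])
    fix u assume u: "u \<in> V" "(v, u) \<in> r\<^sup>*"
    then have "r\<^sup>* `` {u} \<subseteq> r\<^sup>* `` {v}" by auto
    with v(2)[OF u(1)] have "r\<^sup>* `` {u} = r\<^sup>* `` {v}" by (intro card_seteq) auto
    then show "(u, v) \<in> r\<^sup>*" by auto
  qed
qed

context plan_complex
begin

text \<open>The arc from \<open>k\<close> to \<open>c\<close> closes the walk. Counting traversals
  gives the plans \<open>g\<close> on \<open>C\<close> and \<open>h + edge_plan k c\<close> on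
  \<open>B\<close> with equal sums; comparability identifies them, so \<open>g\<close> is positive
  at this edge.\<close>

lemma closed_walk_edge:
  assumes T: "B \<in> T" "C \<in> T" and c: "c \<in> B k"
    and walk: "(Inr c, Inl k) \<in> (walk_step B C)\<^sup>*"
  shows "c \<in> C k"
proof -
  obtain g h where g: "plan C g" and h: "plan B h"
    and r: "\<And>k'. row_sums h $ k' - row_sums g $ k' = - of_bool (k = k')"
    and cs: "\<And>c'. col_sums g $ c' - col_sums h $ c' = of_bool (c = c')"
    using walk_plans[OF walk] by auto
  have h': "plan B (h + edge_plan k c)" using h c by (auto simp: plan_def supported_def edge_plan_def)
  have "g = h + edge_plan k c"
  proof (rule comparable[OF T(2,1) g h'])
    show "row_sums g = row_sums (h + edge_plan k c)"
    proof (rule vec_eq_iff[THEN iffD2], rule allI)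
      fix k' show "row_sums g $ k' = row_sums (h + edge_plan k c) $ k'"
        using r[of k'] by (auto simp: row_sums_add row_sums_edge axis_def)
    qed
    show "col_sums g = col_sums (h + edge_plan k c)"
    proof (rule vec_eq_iff[THEN iffD2], rule allI)
      fix c' show "col_sums g $ c' = col_sums (h + edge_plan k c) $ c'"
        using cs[of c'] by (auto simp: col_sums_add col_sums_edge axis_def)
    qed
  qed
  then have "g $ k $ c = h $ k $ c + 1" by (simp add: edge_plan_def)
  then have "g $ k $ c \<noteq> 0" using plan_nonneg[OF h, of k c] by simp
  then show ?thesis using g by (auto simp: plan_def supported_def)
qed

text \<open>\<open>K\<close> consists of the rows where \<open>A\<close> and \<open>B\<close> differ
  within one strongly connected component of the digraph; there \<open>closed_walk_edge\<close> puts
  \<open>B\<close> inside \<open>C\<close>. The main work is to show that \<open>K\<close> is not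
  empty.\<close>

lemma elimination_step:
  assumes T: "A \<in> T" "B \<in> T" and neq: "A \<noteq> B"
  obtains K where "K \<noteq> {}" "\<And>k. k \<in> K \<Longrightarrow> A k \<noteq> B k"
    "(\<lambda>k. if k \<in> K then A k \<union> B k else A k) \<in> T"
proof -
  define x where "x = uniform_plan A 1"
  define y where "y = uniform_plan B 1"
  have x: "row_sums x = 1" and y: "row_sums y = 1"
    unfolding x_def y_def by (intro row_sums_uniform nonempty T)+
  have tot: "(\<Sum>k\<in>UNIV. (0 :: real ^ 'n) $ k) = (\<Sum>c\<in>UNIV. (col_sums y - col_sums x) $ c)"
    using sum_row_sums[of x] sum_row_sums[of y] by (simp add: sum_subtractf x y)
  have bd: "0 \<le> (col_sums y - col_sums x) $ c" if "\<And>k. c \<notin> A k" for c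
    using that by (auto simp: col_sums_nth x_def y_def uniform_nth intro!: sum_nonneg)
  obtain C w where C: "C \<in> T" "\<And>k. A k \<subseteq> C k" and w: "supported C w" "row_sums w = 0"
    "col_sums w = col_sums y - col_sums x" "\<And>k c. c \<notin> A k \<Longrightarrow> 0 \<le> w $ k $ c"
    using star_direction[OF T(1) tot bd] by metis
  define r where "r = walk_step B C"
  have rB: "(Inl k, Inr c) \<in> r" if "c \<in> B k" for k c using that by (auto simp: r_def walk_step_def)
  have rC: "(Inr c, Inl k) \<in> r" if "c \<in> C k" for k c using that by (auto simp: r_def walk_step_def)
  \<comment> \<open>Columns belong to \<open>V\<close> so that maximality of \<open>v\<close> leads
    from them back to \<open>v\<close>; this closes the walks needed for \<open>BC\<close>.\<close>
  define V where "V = {Inl k |k. A k \<noteq> B k} \<union> {Inr c |c k. A k \<noteq> B k \<and> c \<in> A k \<union> B k}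
    \<union> {Inr c |c k. w $ k $ c \<noteq> 0}"
  obtain k0 where "A k0 \<noteq> B k0" using neq by (auto simp: fun_eq_iff)
  then have "V \<noteq> {}" by (auto simp: V_def)
  then obtain v where v: "v \<in> V" "\<And>u. u \<in> V \<Longrightarrow> (v, u) \<in> r\<^sup>* \<Longrightarrow> (u, v) \<in> r\<^sup>*"
    using finite_preorder_maximal[of V r] by metis
  define U where "U = {u. (v, u) \<in> r\<^sup>*}"
  have UB: "Inr c \<in> U" if "Inl k \<in> U" "c \<in> B k" for k c
    using that rB[of c k] unfolding U_def by (auto intro: rtrancl_into_rtrancl)
  have UC: "Inl k \<in> U" if "Inr c \<in> U" "c \<in> C k" for k c
    using that rC[of c k] unfolding U_def by (auto intro: rtrancl_into_rtrancl)
  show thesis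
  proof (cases "\<exists>k. A k \<noteq> B k \<and> Inl k \<in> U")
    case True
    define K where "K = {k. A k \<noteq> B k \<and> Inl k \<in> U}"
    have BC: "B k \<subseteq> C k" if "k \<in> K" for k
    proof
      fix c assume c: "c \<in> B k"
      have "Inr c \<in> U" using that c UB by (auto simp: K_def)
      moreover have "Inr c \<in> V" using that c by (auto simp: K_def V_def)
      ultimately have "(Inr c, v) \<in> r\<^sup>*" using v(2) by (auto simp: U_def)
      moreover have "(v, Inl k) \<in> r\<^sup>*" using that by (auto simp: K_def U_def)
      ultimately have "(Inr c, Inl k) \<in> r\<^sup>*" by (rule rtrancl_trans)
      then show "c \<in> C k" using closed_walk_edge[OF T(2) C(1) c] by (simp add: r_def)
    qed
    show thesis
    proof (rule that[of K])
      show "K \<noteq> {}" using True by (auto simp: K_def)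
      show "A k \<noteq> B k" if "k \<in> K" for k using that by (simp add: K_def)
      show "(\<lambda>k. if k \<in> K then A k \<union> B k else A k) \<in> T"
        by (rule downward[OF C(1)]) (use C(2) BC nonempty T in auto)
    qed
  next
    case False
    \<comment> \<open>Here no row in \<open>U\<close> distinguishes \<open>A\<close> from
      \<open>B\<close>. No arc leaves \<open>U\<close>: its rows have their \<open>B\<close>-columns
      in \<open>W\<close>, and rows outside have no \<open>C\<close>-column in \<open>W\<close>.
      Comparing the mass on \<open>W\<close> will give a contradiction.\<close>
    define W where "W = {c. Inr c \<in> U}"
    have in_U: "A k = B k" "x $ k = y $ k" "A k \<subseteq> W" if "Inl k \<in> U" for k
    proof -
      show AB: "A k = B k" using that False by blast
      show "x $ k = y $ k" by (simp add: x_def y_def uniform_plan_def AB cong: if_cong)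
      show "A k \<subseteq> W" using UB[OF that] by (auto simp: W_def AB)
    qed
    have not_U: "c \<notin> C k" "w $ k $ c = 0" "x $ k $ c = 0" if "Inl k \<notin> U" "c \<in> W" for k c
    proof -
      show c: "c \<notin> C k" using that UC by (auto simp: W_def)
      then show "w $ k $ c = 0" using w(1) by (simp add: supported_def)
      show "x $ k $ c = 0" using c C(2)[of k] by (auto simp: x_def uniform_nth)
    qed
    \<comment> \<open>The gains of row \<open>k\<close> on \<open>W\<close> under \<open>w\<close>
      and under the passage from \<open>x\<close> to \<open>y\<close>. Their totals agree by the
      column sums of \<open>w\<close>, yet \<open>a k \<le> 0 \<le> b k\<close>, so all of them
      vanish.\<close>
    define a where "a = (\<lambda>k. \<Sum>c\<in>W. w $ k $ c)"
    define b where "b = (\<lambda>k. \<Sum>c\<in>W. y $ k $ c - x $ k $ c)"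
    have ra: "a k = - (\<Sum>c\<in>-W. w $ k $ c)" for k
    proof -
      have "row_sums w $ k = a k + (\<Sum>c\<in>-W. w $ k $ c)"
        unfolding row_sums_nth a_def by (subst sum.union_disjoint[symmetric]) auto
      then show ?thesis using w(2) by simp
    qed
    have wnn: "0 \<le> w $ k $ c" if "Inl k \<in> U" "c \<notin> W" for k c using in_U(3)[OF that(1)] that w(4) by blast
    \<comment> \<open>In a row of \<open>U\<close> the entries of \<open>w\<close> outside
      \<open>W\<close> lie off \<open>A\<close> and are nonnegative, while the row sums to 0. In the
      other rows \<open>w\<close> vanishes on \<open>W\<close>.\<close>
    have a_le: "a k \<le> 0" for k
    proof (cases "Inl k \<in> U")
      case True
      then have "0 \<le> (\<Sum>c\<in>-W. w $ k $ c)" by (intro sum_nonneg wnn) auto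
      then show ?thesis by (simp add: ra)
    next
      case False
      then show ?thesis by (simp add: a_def not_U)
    qed
    have b_ge: "0 \<le> b k" for k
    proof (cases "Inl k \<in> U")
      case True
      then show ?thesis by (simp add: b_def in_U(2))
    next
      case False
      then show ?thesis by (auto simp: b_def not_U y_def uniform_one_nonneg intro!: sum_nonneg)
    qed
    have "(\<Sum>k\<in>UNIV. a k) = (\<Sum>c\<in>W. col_sums w $ c)"
      unfolding a_def col_sums_nth by (rule sum.swap)
    also have "\<dots> = (\<Sum>c\<in>W. \<Sum>k\<in>UNIV. y $ k $ c - x $ k $ c)"
      by (simp add: w(3) col_sums_nth sum_subtractf)
    also have "\<dots> = (\<Sum>k\<in>UNIV. b k)" unfolding b_def by (rule sum.swap)
    finally have ab: "(\<Sum>k\<in>UNIV. a k) = (\<Sum>k\<in>UNIV. b k)" .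
    have "(\<Sum>k\<in>UNIV. b k - a k) = 0" using ab by (simp add: sum_subtractf)
    then have "b k - a k = 0" for k
      using sum_nonneg_eq_0_iff[of UNIV "\<lambda>k. b k - a k"] a_le b_ge
      by (metis UNIV_I diff_ge_0_iff_ge finite order_trans)
    then have ab0: "a k = 0" "b k = 0" for k using a_le[of k] b_ge[of k] by (metis antisym eq_iff_diff_eq_0)+
    have y0: "y $ k $ c = 0" if "Inl k \<notin> U" "c \<in> W" for k c
    proof -
      have "(\<Sum>c\<in>W. y $ k $ c) = 0" using ab0(2)[of k] that by (simp add: b_def not_U)
      then show ?thesis using that
        by (subst (asm) sum_nonneg_eq_0_iff) (auto simp: y_def uniform_one_nonneg)
    qed
    have w0: "w $ k $ c = 0" if "Inl k \<in> U" "c \<notin> W" for k c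
    proof -
      have "(\<Sum>c\<in>-W. w $ k $ c) = 0" using ra[of k] ab0(1)[of k] by simp
      then show ?thesis using that wnn
        by (subst (asm) sum_nonneg_eq_0_iff) auto
    qed
    have vU: "v \<in> U" by (simp add: U_def)
    \<comment> \<open>\<open>v\<close> is no row, as \<open>U\<close> contains no row where the
      types differ. If it were a column at such a row \<open>k\<close>, it would lie in
      \<open>B k\<close> but not in \<open>A k\<close>, and \<open>y\<close> would be positive there
      against \<open>y0\<close>.\<close>
    have "\<exists>c k. v = Inr c \<and> w $ k $ c \<noteq> 0"
    proof (rule ccontr)
      assume "\<not> ?thesis"
      then obtain c k where v': "v = Inr c" "A k \<noteq> B k" "c \<in> A k \<union> B k"
        using v(1) vU False by (auto simp: V_def)
      then have k: "Inl k \<notin> U" and c: "c \<in> W" using False vU by (auto simp: W_def)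
      have "c \<notin> A k" using not_U(1)[OF k c] C(2) by blast
      then have "c \<in> B k" using v' by blast
      then show False using uniform_one_pos[of c B k] y0[OF k c] by (simp add: y_def)
    qed
    then obtain c1 k1 where v': "v = Inr c1" and w1: "w $ k1 $ c1 \<noteq> 0" by blast
    have c1: "c1 \<in> W" using v' vU by (simp add: W_def)
    have k1: "Inl k1 \<in> U" using not_U(2)[OF _ c1] w1 by blast
    \<comment> \<open>All sums of this restriction vanish: on \<open>W\<close> the rows outside
      \<open>U\<close> contribute nothing and the change from \<open>x\<close> to \<open>y\<close>
      is zero, off \<open>W\<close> the rows of \<open>U\<close> contribute nothing. The forest
      \<open>C\<close> then admits only the zero matrix.\<close>
    define w' where "w' = (\<chi> k c. if Inl k \<in> U then w $ k $ c else 0)"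
    have "w' = 0"
    proof (rule supported_eqI[OF potentials[OF C(1)]])
      show "supported C w'" "supported C 0" using w(1) by (auto simp: supported_def w'_def)
      have "row_sums w' $ k = row_sums (0 :: real ^ 'd ^ 'n) $ k" for k
        using arg_cong[OF w(2), of "\<lambda>z. z $ k"] by (cases "Inl k \<in> U") (simp_all add: row_sums_nth w'_def)
      then show "row_sums w' = row_sums (0 :: real ^ 'd ^ 'n)" by (simp add: vec_eq_iff)
      have "col_sums w' $ c = col_sums (0 :: real ^ 'd ^ 'n) $ c" for c
      proof (cases "c \<in> W")
        case True
        have "col_sums w' $ c = col_sums w $ c" unfolding col_sums_nth
          by (intro sum.cong) (auto simp: w'_def not_U(2) True)
        also have "\<dots> = (\<Sum>k\<in>UNIV. y $ k $ c - x $ k $ c)"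
          by (simp add: w(3) col_sums_nth sum_subtractf)
        also have "\<dots> = 0"
        proof (rule sum.neutral, rule ballI)
          fix k show "y $ k $ c - x $ k $ c = 0"
            using in_U(2)[of k] y0[OF _ True, of k] not_U(3)[OF _ True, of k] by (cases "Inl k \<in> U") auto
        qed
        finally show ?thesis by (simp add: col_sums_nth)
      next
        case False
        then show ?thesis by (auto simp: col_sums_nth w'_def w0 intro!: sum.neutral)
      qed
      then show "col_sums w' = col_sums (0 :: real ^ 'd ^ 'n)" by (simp add: vec_eq_iff)
    qed
    then have "w' $ k1 $ c1 = 0" by simp
    then show thesis using w1 k1 by (simp add: w'_def)
  qed
qed

theorem elimination:
  assumes "A \<in> T" "B \<in> T"
  shows "\<exists>C\<in>T. C j = A j \<union> B j \<and> (\<forall>k. C k \<in> {A k, B k, A k \<union> B k})"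
  using assms
proof (induction "card {k. A k \<noteq> B k}" arbitrary: A rule: less_induct)
  case less
  show ?case
  proof (cases "A j = B j")
    case True
    then show ?thesis using less.prems by (intro bexI[of _ A]) auto
  next
    case False
    then have "A \<noteq> B" by auto
    then obtain K where K: "K \<noteq> {}" "\<And>k. k \<in> K \<Longrightarrow> A k \<noteq> B k"
      "(\<lambda>k. if k \<in> K then A k \<union> B k else A k) \<in> T"
      by (rule elimination_step[OF less.prems]) blast
    show ?thesis
    proof (cases "j \<in> K")
      case True
      then show ?thesis using K(3) by (intro bexI) auto
    next
      case jK: False
      define A' where "A' = (\<lambda>k. if k \<in> K then B k else A k)"
      have "A' \<in> T" by (rule downward[OF K(3)]) (use nonempty less.prems in \<open>auto simp: A'_def\<close>)
      moreover have "card {k. A' k \<noteq> B k} < card {k. A k \<noteq> B k}"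
        by (rule psubset_card_mono) (use K in \<open>auto simp: A'_def\<close>)
      ultimately obtain D where D: "D \<in> T" "D j = A' j \<union> B j"
        "\<And>k. D k \<in> {A' k, B k, A' k \<union> B k}"
        using less.hyps[of A'] less.prems by blast
      have "D k \<in> {A k, B k, A k \<union> B k}" for k
        using D(3)[of k] by (auto simp: A'_def split: if_splits)
      then show ?thesis using D jK by (intro bexI[of _ D]) (auto simp: A'_def)
    qed
  qed
qed

end

section \<open>Mixed cells and their faces\<close>

lemma Delta_iff:
  "v \<in> Delta J \<longleftrightarrow> (\<forall>c. 0 \<le> v $ c) \<and> (\<forall>c. c \<notin> J \<longrightarrow> v $ c = 0) \<and> (\<Sum>c\<in>UNIV. v $ c) = 1"
  (is "_ \<longleftrightarrow> ?P v")
proof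
  have "convex {v. ?P v}"
  proof (rule convexI)
    fix v v' :: "real ^ 'a" and s t :: real
    assume "v \<in> {v. ?P v}" "v' \<in> {v. ?P v}" and "0 \<le> s" "0 \<le> t" "s + t = 1"
    then show "s *\<^sub>R v + t *\<^sub>R v' \<in> {v. ?P v}"
      by (simp add: sum.distrib sum_distrib_left[symmetric])
  qed
  moreover have "(\<lambda>j. axis j 1) ` J \<subseteq> {v. ?P v}" by (auto simp: axis_def)
  ultimately have "Delta J \<subseteq> {v. ?P v}" unfolding Delta_def by (intro hull_minimal)
  then show "v \<in> Delta J \<Longrightarrow> ?P v" by blast
next
  assume v: "?P v"
  have "(\<Sum>c\<in>J. v $ c *\<^sub>R axis c 1) \<in> Delta J"
  proof (rule convex_sum)
    show "convex (Delta J)" unfolding Delta_def by (rule convex_convex_hull)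
    have "(\<Sum>c\<in>J. v $ c) = (\<Sum>c\<in>UNIV. v $ c)" using v by (intro sum.mono_neutral_left) auto
    then show "(\<Sum>c\<in>J. v $ c) = 1" using v by simp
    show "axis c 1 \<in> Delta J" if "c \<in> J" for c unfolding Delta_def using that by (intro hull_inc) auto
  qed (use v in auto)
  also have "(\<Sum>c\<in>J. v $ c *\<^sub>R axis c 1) = v"
    using v by (auto simp: vec_eq_iff axis_def if_distrib cong: if_cong)
  finally show "v \<in> Delta J" .
qed

lemma Delta_Int: "Delta I \<inter> Delta J = Delta (I \<inter> J)"
  by (auto simp: Delta_iff)

text \<open>Row \<open>k\<close> of a unit plan holds the barycentric coordinates of the summand
  taken from the \<open>k\<close>-th simplex; as the vertices are unit vectors, it is that summand
  itself.\<close>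

lemma mixed_cell_eq: "mixed_cell A = col_sums ` unit_plans A"
proof
  show "mixed_cell A \<subseteq> col_sums ` unit_plans A"
  proof
    fix z assume "z \<in> mixed_cell A"
    then obtain x where x: "z = (\<Sum>i\<in>UNIV. x i)" "\<And>i. x i \<in> Delta (A i)"
      by (auto simp: mixed_cell_def minkowski_sum_def)
    then have "(\<chi> i. x i) \<in> unit_plans A"
      by (auto simp: unit_plans_def plan_def supported_def Delta_iff vec_eq_iff row_sums_nth)
    moreover have "col_sums (\<chi> i. x i) = z" by (simp add: col_sums_def x)
    ultimately show "z \<in> col_sums ` unit_plans A" by blast
  qed
  show "col_sums ` unit_plans A \<subseteq> mixed_cell A"
  proof clarify
    fix f assume "f \<in> unit_plans A"
    then have "f $ i \<in> Delta (A i)" for i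
      by (auto simp: unit_plans_def plan_def supported_def Delta_iff vec_eq_iff row_sums_nth)
    then show "col_sums f \<in> mixed_cell A"
      by (auto simp: mixed_cell_def minkowski_sum_def col_sums_def)
  qed
qed

lemma minkowski_sum_Delta_Int:
  "minkowski_sum (\<lambda>i. Delta (A i) \<inter> Delta (B i)) = mixed_cell (\<lambda>i. A i \<inter> B i)"
  by (simp add: mixed_cell_def Delta_Int)

lemma dilated_simplex_iff:
  "z \<in> (\<lambda>x. real CARD('n::finite) *\<^sub>R x) ` Delta UNIV \<longleftrightarrow>
    (\<forall>c. 0 \<le> z $ c) \<and> (\<Sum>c\<in>UNIV. z $ c) = real CARD('n)"
proof
  assume "(\<forall>c. 0 \<le> z $ c) \<and> (\<Sum>c\<in>UNIV. z $ c) = real CARD('n)"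
  then have "(1 / real CARD('n)) *\<^sub>R z \<in> Delta UNIV"
    by (simp add: Delta_iff sum_distrib_left[symmetric] sum_divide_distrib[symmetric])
  moreover have "z = real CARD('n) *\<^sub>R ((1 / real CARD('n)) *\<^sub>R z)" by simp
  ultimately show "z \<in> (\<lambda>x. real CARD('n) *\<^sub>R x) ` Delta UNIV" by blast
qed (auto simp: Delta_iff sum_distrib_left[symmetric])

lemma polytope_mixed_cell:
  fixes A :: "'n::finite \<Rightarrow> 'd::finite set"
  shows "polytope (mixed_cell A)"
proof -
  define P where "P = (\<lambda>F. (\<lambda>x. \<Sum>i\<in>F. x i) ` {x. \<forall>i\<in>F. x i \<in> Delta (A i)})"
  have lin: "linear (\<lambda>p :: (real ^ 'd) \<times> (real ^ 'd). fst p + snd p)"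
    by (intro linearI) (simp_all add: algebra_simps)
  have "polytope (P F)" if "finite F" for F
    using that
  proof (induction F)
    case empty
    have "P {} = convex hull {0}" by (simp add: P_def image_constant_conv)
    then show ?case by (simp only: polytope_convex_hull finite.intros)
  next
    case (insert k F)
    have "polytope (Delta (A k))" unfolding Delta_def by (intro polytope_convex_hull) simp
    then have "polytope ((\<lambda>p. fst p + snd p) ` (Delta (A k) \<times> P F))"
      using insert.IH by (intro polytope_linear_image[OF lin] polytope_Times)
    also have "(\<lambda>p. fst p + snd p) ` (Delta (A k) \<times> P F) = P (insert k F)"
    proof (intro equalityI subsetI)
      fix z assume "z \<in> (\<lambda>p. fst p + snd p) ` (Delta (A k) \<times> P F)"
      then obtain a x where z: "z = a + sum x F" and a: "a \<in> Delta (A k)" and x: "\<forall>i\<in>F. x i \<in> Delta (A i)"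
        unfolding P_def by force
      have "sum (x(k := a)) F = sum x F" using insert.hyps by (intro sum.cong) auto
      then have "z = sum (x(k := a)) (insert k F)" using insert.hyps z by simp
      moreover have "\<forall>i\<in>insert k F. (x(k := a)) i \<in> Delta (A i)" using a x by auto
      ultimately show "z \<in> P (insert k F)" unfolding P_def by blast
    next
      fix z assume "z \<in> P (insert k F)"
      then obtain x where x: "z = sum x (insert k F)" "\<forall>i\<in>insert k F. x i \<in> Delta (A i)"
        unfolding P_def by blast
      then have "(x k, sum x F) \<in> Delta (A k) \<times> P F" unfolding P_def by blast
      moreover have "z = fst (x k, sum x F) + snd (x k, sum x F)" using x insert.hyps by simp
      ultimately show "z \<in> (\<lambda>p. fst p + snd p) ` (Delta (A k) \<times> P F)" by blast
    qed
    finally show ?case .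
  qed
  then have "polytope (P UNIV)" by simp
  also have "P UNIV = mixed_cell A" unfolding P_def mixed_cell_def minkowski_sum_def by blast
  finally show ?thesis .
qed

lemma unit_plans_mono:
  assumes "f \<in> unit_plans A" "\<And>k. A k \<subseteq> B k"
  shows "f \<in> unit_plans B"
proof -
  have "plan B f" by (rule plan_mono[OF _ assms(2)]) (use assms(1) in \<open>simp add: unit_plans_def\<close>)
  then show ?thesis using assms(1) by (simp add: unit_plans_def)
qed

lemma mixed_cell_mono:
  assumes "\<And>k. A k \<subseteq> B k"
  shows "mixed_cell A \<subseteq> mixed_cell B"
  unfolding mixed_cell_eq by (rule image_mono, rule subsetI) (rule unit_plans_mono[OF _ assms])

lemma mixed_cell_nonempty:
  fixes A :: "'n::finite \<Rightarrow> 'd::finite set"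
  assumes "\<And>k. A k \<noteq> {}"
  shows "mixed_cell A \<noteq> {}"
proof -
  have "uniform_plan A 1 \<in> unit_plans A" by (rule uniform_in_unit_plans) (rule assms)
  then show ?thesis unfolding mixed_cell_eq by (metis empty_iff image_eqI)
qed

lemma unit_plan_nonempty:
  fixes A :: "'n::finite \<Rightarrow> 'd::finite set"
  assumes f: "f \<in> unit_plans A"
  shows "A k \<noteq> {}"
proof
  assume Ak: "A k = {}"
  have "f $ k $ c = 0" for c
    using f unfolding unit_plans_def plan_def supported_def by (metis (mono_tags, lifting) Ak empty_iff mem_Collect_eq)
  then have "row_sums f $ k = 0" unfolding row_sums_nth by simp
  moreover have "row_sums f = 1" using f by (simp only: unit_plans_def mem_Collect_eq)
  ultimately show False by simp
qed

text \<open>Compare the maxima of the coordinate \<open>c\<close> on both cells: it counts the \<open>k\<close> with \<open>c \<in> A k\<close>.\<close>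

lemma mixed_cell_subset_imp_eq:
  fixes A B :: "'n::finite \<Rightarrow> 'd::finite set"
  assumes "\<And>k. A k \<noteq> {}" and BA: "\<And>k. B k \<subseteq> A k" and sub: "mixed_cell A \<subseteq> mixed_cell B"
  shows "A = B"
proof -
  have "A k0 \<subseteq> B k0" for k0
  proof
    fix c assume c: "c \<in> A k0"
    \<comment> \<open>One vertex of each simplex, namely \<open>c\<close> wherever possible, so that
      the plan built from them maximises coordinate \<open>c\<close> on the cell.\<close>
    define \<sigma> where "\<sigma> = (\<lambda>k. if c \<in> A k then c else SOME c. c \<in> A k)"
    have \<sigma>: "\<sigma> k \<in> A k" for k using assms(1)[of k] by (simp add: \<sigma>_def some_in_eq)
    have \<sigma>c: "\<sigma> k = c \<longleftrightarrow> c \<in> A k" for k using \<sigma>[of k] by (metis \<sigma>_def)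
    define f :: "real ^ 'd ^ 'n" where "f = (\<chi> k. axis (\<sigma> k) 1)"
    have "f $ k $ c' = 0" if "c' \<notin> A k" for k c' using that \<sigma>[of k] by (auto simp: f_def axis_def)
    moreover have "0 \<le> f $ k $ c'" for k c' by (simp add: f_def axis_def)
    moreover have "row_sums f = 1" by (simp add: f_def vec_eq_iff row_sums_nth axis_def)
    ultimately have "f \<in> unit_plans A" by (simp add: unit_plans_def plan_def supported_def)
    then have "col_sums f \<in> mixed_cell B" using sub unfolding mixed_cell_eq by blast
    then obtain g where g: "g \<in> unit_plans B" "col_sums f = col_sums g"
      unfolding mixed_cell_eq by blast
    have "f $ k $ c = of_bool (c \<in> A k)" for k using \<sigma>c[of k] by (auto simp: f_def axis_def)
    then have "real (card {k. c \<in> A k}) = col_sums f $ c"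
      by (simp add: col_sums_nth)
    also have "\<dots> = (\<Sum>k\<in>UNIV. g $ k $ c)" by (simp add: g(2) col_sums_nth)
    also have "\<dots> = (\<Sum>k | c \<in> B k. g $ k $ c)"
      using g(1) by (intro sum.mono_neutral_right) (auto simp: unit_plans_def plan_def supported_def)
    also have "\<dots> \<le> (\<Sum>k | c \<in> B k. 1)"
    proof (rule sum_mono)
      fix k show "g $ k $ c \<le> 1"
        using g(1) plan_le_row_sum[of B g k c] by (simp add: unit_plans_def)
    qed
    finally have "card {k. c \<in> A k} \<le> card {k. c \<in> B k}" by simp
    moreover have "{k. c \<in> B k} \<subseteq> {k. c \<in> A k}" using BA by blast
    ultimately have "{k. c \<in> B k} = {k. c \<in> A k}" by (intro card_seteq) auto
    then show "c \<in> B k0" using c by blast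
  qed
  then show ?thesis using BA by (intro ext equalityI)
qed

section \<open>Faces of mixed cells and their types\<close>

text \<open>The face of a Minkowski sum in direction \<open>a\<close> is the sum of the faces of the
  summands in that direction; this is the type of that face.\<close>

definition max_type :: "real ^ 'd \<Rightarrow> ('n \<Rightarrow> 'd set) \<Rightarrow> 'n \<Rightarrow> 'd set" where
  "max_type a A k = {c \<in> A k. \<forall>c'\<in>A k. a $ c' \<le> a $ c}"

lemma max_type_subset: "max_type a A k \<subseteq> A k"
  by (auto simp: max_type_def)

lemma max_type_nonempty:
  fixes A :: "'n \<Rightarrow> 'd::finite set"
  assumes "A k \<noteq> {}" shows "max_type a A k \<noteq> {}"
proof -
  have "Max ((($) a) ` A k) \<in> (($) a) ` A k" using assms by (intro Max_in) auto
  then obtain c where "c \<in> A k" "a $ c = Max ((($) a) ` A k)" by auto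
  then have "c \<in> max_type a A k" by (auto simp: max_type_def)
  then show ?thesis by blast
qed

lemma inner_col_sums: "a \<bullet> col_sums f = (\<Sum>k\<in>UNIV. \<Sum>c\<in>UNIV. a $ c * f $ k $ c)"
proof -
  have "a \<bullet> col_sums f = (\<Sum>c\<in>UNIV. \<Sum>k\<in>UNIV. a $ c * f $ k $ c)"
    by (simp add: inner_vec_def col_sums_nth sum_distrib_left)
  also have "\<dots> = (\<Sum>k\<in>UNIV. \<Sum>c\<in>UNIV. a $ c * f $ k $ c)" by (rule sum.swap)
  finally show ?thesis .
qed

text \<open>As rows sum to 1, the gap between the two sides is the sum of the nonnegative terms
  \<open>(m k - \<omega> k c) * f $ k $ c\<close>. It vanishes exactly when \<open>f\<close> lives
  on the edges of weight \<open>m k\<close>.\<close>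

lemma unit_plans_weighted:
  fixes A :: "'n::finite \<Rightarrow> 'd::finite set" and \<omega> :: "'n \<Rightarrow> 'd \<Rightarrow> real"
  assumes f: "f \<in> unit_plans A" and le: "\<And>k c. c \<in> A k \<Longrightarrow> \<omega> k c \<le> m k"
  shows "(\<Sum>k\<in>UNIV. \<Sum>c\<in>UNIV. \<omega> k c * f $ k $ c) \<le> sum m UNIV"
    and "(\<Sum>k\<in>UNIV. \<Sum>c\<in>UNIV. \<omega> k c * f $ k $ c) = sum m UNIV \<longleftrightarrow>
      f \<in> unit_plans (\<lambda>k. {c \<in> A k. \<omega> k c = m k})"
proof -
  have nn: "0 \<le> f $ k $ c" for k c using f by (simp add: unit_plans_def plan_def)
  have z: "f $ k $ c = 0" if "c \<notin> A k" for k c using f that by (simp add: unit_plans_def plan_def supported_def)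
  have "sum m UNIV = (\<Sum>k\<in>UNIV. m k * row_sums f $ k)" using f by (simp add: unit_plans_def)
  also have "\<dots> = (\<Sum>k\<in>UNIV. \<Sum>c\<in>UNIV. m k * f $ k $ c)" by (simp add: row_sums_nth sum_distrib_left)
  finally have eq: "sum m UNIV - (\<Sum>k\<in>UNIV. \<Sum>c\<in>UNIV. \<omega> k c * f $ k $ c) =
      (\<Sum>k\<in>UNIV. \<Sum>c\<in>UNIV. (m k - \<omega> k c) * f $ k $ c)"
    by (simp add: left_diff_distrib sum_subtractf)
  have t: "0 \<le> (m k - \<omega> k c) * f $ k $ c" for k c
    using le[of c k] nn[of k c] z[of c k] by (cases "c \<in> A k") auto
  show "(\<Sum>k\<in>UNIV. \<Sum>c\<in>UNIV. \<omega> k c * f $ k $ c) \<le> sum m UNIV"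
  proof -
    have "0 \<le> (\<Sum>k\<in>UNIV. \<Sum>c\<in>UNIV. (m k - \<omega> k c) * f $ k $ c)" by (intro sum_nonneg t)
    then show ?thesis using eq by linarith
  qed
  have "(\<Sum>k\<in>UNIV. \<Sum>c\<in>UNIV. \<omega> k c * f $ k $ c) = sum m UNIV \<longleftrightarrow>
      (\<Sum>k\<in>UNIV. \<Sum>c\<in>UNIV. (m k - \<omega> k c) * f $ k $ c) = 0" using eq by linarith
  also have "\<dots> \<longleftrightarrow> (\<forall>k c. (m k - \<omega> k c) * f $ k $ c = 0)"
    using t by (simp add: sum_nonneg_eq_0_iff sum_nonneg)
  also have "\<dots> \<longleftrightarrow> f \<in> unit_plans (\<lambda>k. {c \<in> A k. \<omega> k c = m k})"
    using f by (simp add: unit_plans_def plan_def supported_def) metis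
  finally show "(\<Sum>k\<in>UNIV. \<Sum>c\<in>UNIV. \<omega> k c * f $ k $ c) = sum m UNIV \<longleftrightarrow>
      f \<in> unit_plans (\<lambda>k. {c \<in> A k. \<omega> k c = m k})" .
qed

lemma max_type_face:
  fixes A :: "'n::finite \<Rightarrow> 'd::finite set" and a :: "real ^ 'd"
  assumes ne: "\<And>k. A k \<noteq> {}"
  obtains b where "\<And>z. z \<in> mixed_cell A \<Longrightarrow> a \<bullet> z \<le> b"
    "\<And>f. f \<in> unit_plans A \<Longrightarrow> a \<bullet> col_sums f = b \<longleftrightarrow> f \<in> unit_plans (max_type a A)"
proof -
  define m where "m = (\<lambda>k. Max ((($) a) ` A k))"
  have le: "a $ c \<le> m k" if "c \<in> A k" for k c using that by (simp add: m_def)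
  have mt: "max_type a A = (\<lambda>k. {c \<in> A k. a $ c = m k})"
  proof
    fix k
    have "m k \<in> (($) a) ` A k" unfolding m_def using ne by (intro Max_in) auto
    then show "max_type a A k = {c \<in> A k. a $ c = m k}"
      using le[of _ k] by (auto simp: max_type_def intro: antisym)
  qed
  show thesis
  proof (rule that[of "sum m UNIV"])
    show "a \<bullet> z \<le> sum m UNIV" if "z \<in> mixed_cell A" for z
      using that unit_plans_weighted(1)[of _ A "\<lambda>k c. a $ c" m] le
      by (auto simp: mixed_cell_eq inner_col_sums)
    show "a \<bullet> col_sums f = sum m UNIV \<longleftrightarrow> f \<in> unit_plans (max_type a A)" if "f \<in> unit_plans A" for f
      unfolding mt inner_col_sums using unit_plans_weighted(2)[OF that, of "\<lambda>k c. a $ c" m] le by simp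
  qed
qed

lemma mixed_cell_max_type_eq:
  assumes "\<And>f. f \<in> unit_plans A \<Longrightarrow> a \<bullet> col_sums f = b \<longleftrightarrow> f \<in> unit_plans (max_type a A)"
  shows "mixed_cell (max_type a A) = mixed_cell A \<inter> {z. a \<bullet> z = b}"
proof (intro equalityI subsetI)
  fix z assume "z \<in> mixed_cell (max_type a A)"
  then obtain f where f: "z = col_sums f" "f \<in> unit_plans (max_type a A)" by (auto simp: mixed_cell_eq)
  then have "f \<in> unit_plans A" using unit_plans_mono max_type_subset by metis
  then show "z \<in> mixed_cell A \<inter> {z. a \<bullet> z = b}" using f assms by (auto simp: mixed_cell_eq)
next
  fix z assume "z \<in> mixed_cell A \<inter> {z. a \<bullet> z = b}"
  then show "z \<in> mixed_cell (max_type a A)" using assms by (auto simp: mixed_cell_eq)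
qed

text \<open>For the second claim: the value of \<open>a\<close> depends on the point alone, so every
  plan on \<open>A\<close> over a point of the face is supported on the type of the face.\<close>

lemma max_type_face_of:
  fixes A :: "'n::finite \<Rightarrow> 'd::finite set"
  assumes "\<And>k. A k \<noteq> {}"
  shows "mixed_cell (max_type a A) face_of mixed_cell A"
    and "f \<in> unit_plans A \<Longrightarrow> col_sums f \<in> mixed_cell (max_type a A) \<longleftrightarrow> f \<in> unit_plans (max_type a A)"
proof -
  obtain b where b: "\<And>z. z \<in> mixed_cell A \<Longrightarrow> a \<bullet> z \<le> b"
    "\<And>f. f \<in> unit_plans A \<Longrightarrow> a \<bullet> col_sums f = b \<longleftrightarrow> f \<in> unit_plans (max_type a A)"
    using max_type_face[where A = A and a = a, OF assms] by blast
  have eq: "mixed_cell (max_type a A) = mixed_cell A \<inter> {z. a \<bullet> z = b}"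
    by (rule mixed_cell_max_type_eq) (rule b(2))
  show "mixed_cell (max_type a A) face_of mixed_cell A"
    unfolding eq using b(1) polytope_imp_convex[OF polytope_mixed_cell]
    by (intro face_of_Int_supporting_hyperplane_le) auto
  show "col_sums f \<in> mixed_cell (max_type a A) \<longleftrightarrow> f \<in> unit_plans (max_type a A)"
    if "f \<in> unit_plans A"
    unfolding eq using b(2)[OF that] that by (auto simp: mixed_cell_eq)
qed

text \<open>Faces of a polytope are exposed, and an exposing functional serves as \<open>a\<close>.
  Its level is the maximum on the cell, which is attained both on \<open>F\<close> and at the
  uniform plan of the maximal type.\<close>

lemma face_of_mixed_cell:
  fixes A :: "'n::finite \<Rightarrow> 'd::finite set"
  assumes ne: "\<And>k. A k \<noteq> {}" and F: "F face_of mixed_cell A" "F \<noteq> {}"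
  obtains a where "F = mixed_cell (max_type a A)"
proof -
  have "F exposed_face_of mixed_cell A"
    using F(1) exposed_face_of_polyhedron polytope_imp_polyhedron[OF polytope_mixed_cell] by blast
  then obtain a b' where le: "mixed_cell A \<subseteq> {z. a \<bullet> z \<le> b'}" and eq: "F = mixed_cell A \<inter> {z. a \<bullet> z = b'}"
    by (auto simp: exposed_face_of_def)
  obtain b where b: "\<And>z. z \<in> mixed_cell A \<Longrightarrow> a \<bullet> z \<le> b"
    "\<And>f. f \<in> unit_plans A \<Longrightarrow> a \<bullet> col_sums f = b \<longleftrightarrow> f \<in> unit_plans (max_type a A)"
    using max_type_face[where A = A and a = a, OF ne] by blast
  have "b = b'"
  proof (rule antisym)
    show "b' \<le> b" using F(2) eq b(1) by fastforce
    have u: "uniform_plan (max_type a A) 1 \<in> unit_plans (max_type a A)"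
      by (intro uniform_in_unit_plans max_type_nonempty ne)
    then have u': "uniform_plan (max_type a A) 1 \<in> unit_plans A" by (rule unit_plans_mono) (rule max_type_subset)
    show "b \<le> b'" using b(2)[OF u'] u u' le by (force simp: mixed_cell_eq)
  qed
  then have "F = mixed_cell (max_type a A)"
    using mixed_cell_max_type_eq[of A a b] b(2) eq by blast
  then show thesis by (rule that)
qed

lemma uniform_unit_plans_subset:
  fixes A :: "'n::finite \<Rightarrow> 'd::finite set"
  assumes "uniform_plan A 1 \<in> unit_plans B"
  shows "A k \<subseteq> B k"
proof
  fix c assume "c \<in> A k"
  from uniform_one_pos[of c A k, OF this] assms show "c \<in> B k"
    by (force simp: unit_plans_def plan_def supported_def)
qed

section \<open>Fine mixed subdivisions\<close>

lemma mixed_subdivision_nonempty: "mixed_subdivision M \<Longrightarrow> A \<in> M \<Longrightarrow> A k \<noteq> {}"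
  by (simp add: mixed_subdivision_def)

lemma mixed_subdivision_Int:
  "mixed_subdivision M \<Longrightarrow> A \<in> M \<Longrightarrow> B \<in> M \<Longrightarrow>
    mixed_cell A \<inter> mixed_cell B = mixed_cell (\<lambda>k. A k \<inter> B k)"
  by (simp add: mixed_subdivision_def minkowski_sum_Delta_Int)

text \<open>This passes from points to plans: the intersection of the cells is a face of cell
  \<open>A\<close>, its type as a face turns out to be the intersection type, and every plan on
  \<open>A\<close> over the face is supported on that type.\<close>

lemma mixed_subdivision_plan_Int:
  fixes M :: "('n::finite \<Rightarrow> 'd::finite set) set"
  assumes M: "mixed_subdivision M" and A: "A \<in> M" "B \<in> M"
    and f: "f \<in> unit_plans A" and z: "col_sums f \<in> mixed_cell B"
  shows "f \<in> unit_plans (\<lambda>k. A k \<inter> B k)"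
proof -
  let ?I = "\<lambda>k. A k \<inter> B k" and ?F = "mixed_cell A \<inter> mixed_cell B"
  have ne: "A k \<noteq> {}" for k by (rule mixed_subdivision_nonempty[OF M A(1)])
  have fF: "col_sums f \<in> ?F" using imageI[OF f, of col_sums] z by (simp add: mixed_cell_eq)
  have I: "?F = mixed_cell ?I" by (rule mixed_subdivision_Int[OF M A])
  have "?F face_of mixed_cell A"
    using M A unfolding mixed_subdivision_def polyhedral_subdivision_def by blast
  then obtain a where a: "?F = mixed_cell (max_type a A)"
    using face_of_mixed_cell[of A ?F, OF ne] fF by blast
  have aI: "mixed_cell (max_type a A) = mixed_cell ?I" by (rule trans[OF a[symmetric] I])
  have "col_sums f \<in> mixed_cell ?I" using fF by (simp only: I)
  then obtain g where "g \<in> unit_plans ?I" unfolding mixed_cell_eq by (rule imageE)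
  then have Ine: "?I k \<noteq> {}" for k by (rule unit_plan_nonempty)
  have u: "uniform_plan ?I 1 \<in> unit_plans ?I" by (rule uniform_in_unit_plans) (rule Ine)
  have uA: "uniform_plan ?I 1 \<in> unit_plans A" by (rule unit_plans_mono[OF u]) blast
  \<comment> \<open>The uniform plan is positive on all edges of \<open>?I\<close>, so its lying on
    the face type gives one inclusion of types; equality of the cells forces the other.\<close>
  have "col_sums (uniform_plan ?I 1) \<in> mixed_cell (max_type a A)"
    unfolding aI unfolding mixed_cell_eq using u by (rule imageI)
  then have "uniform_plan ?I 1 \<in> unit_plans (max_type a A)"
    using max_type_face_of(2)[of A, OF ne uA] by simp
  then have sub: "?I k \<subseteq> max_type a A k" for k by (rule uniform_unit_plans_subset)
  have "max_type a A = ?I"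
  proof (rule mixed_cell_subset_imp_eq)
    show "max_type a A k \<noteq> {}" for k by (rule max_type_nonempty) (rule ne)
    show "?I k \<subseteq> max_type a A k" for k by (rule sub)
    show "mixed_cell (max_type a A) \<subseteq> mixed_cell ?I" by (simp only: aI order_refl)
  qed
  moreover have "f \<in> unit_plans (max_type a A)"
    using max_type_face_of(2)[of A, OF ne f] fF by (simp only: a)
  ultimately show ?thesis by simp
qed

text \<open>Closure under faces yields only a type \<open>B\<close> with the same underlying cell.
  Plans show that \<open>B\<close> is contained in the face type, and nested types with equal cells
  coincide.\<close>

lemma mixed_subdivision_max_type:
  fixes M :: "('n::finite \<Rightarrow> 'd::finite set) set"
  assumes M: "mixed_subdivision M" and A: "A \<in> M"
  shows "max_type a A \<in> M"
proof -
  have ne: "A k \<noteq> {}" for k by (rule mixed_subdivision_nonempty[OF M A])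
  have mne: "max_type a A k \<noteq> {}" for k by (rule max_type_nonempty) (rule ne)
  have "mixed_cell (max_type a A) face_of mixed_cell A" by (rule max_type_face_of(1)) (rule ne)
  moreover have "mixed_cell (max_type a A) \<noteq> {}" by (rule mixed_cell_nonempty) (rule mne)
  ultimately have "mixed_cell (max_type a A) \<in> mixed_cell ` M"
    using M A unfolding mixed_subdivision_def polyhedral_subdivision_def by blast
  then obtain B where B: "B \<in> M" "mixed_cell (max_type a A) = mixed_cell B" by blast
  have Bne: "B k \<noteq> {}" for k by (rule mixed_subdivision_nonempty[OF M B(1)])
  have u: "uniform_plan B 1 \<in> unit_plans B" by (rule uniform_in_unit_plans) (rule Bne)
  then have uc: "col_sums (uniform_plan B 1) \<in> mixed_cell (max_type a A)"
    unfolding B(2) unfolding mixed_cell_eq by (rule imageI)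
  have "mixed_cell (max_type a A) \<subseteq> mixed_cell A" by (rule mixed_cell_mono) (rule max_type_subset)
  then have "col_sums (uniform_plan B 1) \<in> mixed_cell A" using uc by (rule subsetD)
  then have "uniform_plan B 1 \<in> unit_plans (\<lambda>k. B k \<inter> A k)"
    by (rule mixed_subdivision_plan_Int[OF M B(1) A u])
  then have "uniform_plan B 1 \<in> unit_plans A" by (rule unit_plans_mono) blast
  then have "uniform_plan B 1 \<in> unit_plans (max_type a A)"
    using max_type_face_of(2)[of A, OF ne] uc by simp
  then have "B k \<subseteq> max_type a A k" for k by (rule uniform_unit_plans_subset)
  then have "max_type a A = B"
    by (intro mixed_cell_subset_imp_eq mne) (simp_all only: B(2) order_refl)
  then show ?thesis using B(1) by simp
qed

section \<open>Refinement by heights and duality for transport problems\<close>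

text \<open>
  The lower faces of the cell \<open>A\<close> lifted by the heights \<open>\<omega>\<close>: complementary slackness for the
  minimal cost transport problem on \<open>A\<close>.
\<close>

definition tight_in :: "('n \<Rightarrow> 'd \<Rightarrow> real) \<Rightarrow> ('n \<Rightarrow> 'd set) \<Rightarrow> ('n \<Rightarrow> real) \<Rightarrow> real ^ 'd \<Rightarrow>
    ('n \<Rightarrow> 'd set) \<Rightarrow> bool" where
  "tight_in \<omega> A \<alpha> \<beta> B \<longleftrightarrow> (\<forall>k. B k \<noteq> {}) \<and> (\<forall>k. \<forall>c\<in>A k. \<alpha> k + \<beta> $ c \<le> \<omega> k c) \<and>
     B = (\<lambda>k. {c \<in> A k. \<alpha> k + \<beta> $ c = \<omega> k c})"

text \<open>The potentials may vary from cell to cell, but the heights are shared; this makes the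
  pieces of different cells fit together.\<close>

definition regular_refinement :: "('n \<Rightarrow> 'd::finite \<Rightarrow> real) \<Rightarrow> ('n \<Rightarrow> 'd set) set \<Rightarrow> ('n \<Rightarrow> 'd set) set" where
  "regular_refinement \<omega> M = {B. \<exists>A\<in>M. \<exists>\<alpha> \<beta>. tight_in \<omega> A \<alpha> \<beta> B}"

lemma tight_in_subset: "tight_in \<omega> A \<alpha> \<beta> B \<Longrightarrow> B k \<subseteq> A k"
  by (auto simp: tight_in_def)

definition cost :: "('n \<Rightarrow> 'd \<Rightarrow> real) \<Rightarrow> real ^ 'd ^ 'n \<Rightarrow> real" where
  "cost \<omega> f = (\<Sum>k\<in>UNIV. \<Sum>c\<in>UNIV. \<omega> k c * f $ k $ c)"

text \<open>Weak duality and complementary slackness: \<open>unit_plans_weighted\<close> for the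
  weights \<open>\<beta> $ c - \<omega> k c\<close> with row bounds
  \<open>- \<alpha> k\<close>.\<close>

lemma tight_in_cost:
  fixes A B :: "'n::finite \<Rightarrow> 'd::finite set"
  assumes t: "tight_in \<omega> A \<alpha> \<beta> B" and f: "f \<in> unit_plans A"
  shows "\<beta> \<bullet> col_sums f + sum \<alpha> UNIV \<le> cost \<omega> f"
    and "\<beta> \<bullet> col_sums f + sum \<alpha> UNIV = cost \<omega> f \<longleftrightarrow> f \<in> unit_plans B"
proof -
  have eq: "(\<Sum>k\<in>UNIV. \<Sum>c\<in>UNIV. (\<beta> $ c - \<omega> k c) * f $ k $ c) = \<beta> \<bullet> col_sums f - cost \<omega> f"
    by (simp add: inner_col_sums cost_def left_diff_distrib sum_subtractf)
  have le: "\<beta> $ c - \<omega> k c \<le> - \<alpha> k" if "c \<in> A k" for k c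
  proof -
    have "\<alpha> k + \<beta> $ c \<le> \<omega> k c" using t that by (simp add: tight_in_def)
    then show ?thesis by simp
  qed
  have "{c \<in> A k. \<beta> $ c - \<omega> k c = - \<alpha> k} = {c \<in> A k. \<alpha> k + \<beta> $ c = \<omega> k c}" for k by auto
  then have B: "(\<lambda>k. {c \<in> A k. \<beta> $ c - \<omega> k c = - \<alpha> k}) = B" using t by (simp add: tight_in_def)
  have neg: "(\<Sum>k\<in>UNIV. - \<alpha> k) = - sum \<alpha> UNIV" by (rule sum_negf)
  show "\<beta> \<bullet> col_sums f + sum \<alpha> UNIV \<le> cost \<omega> f"
    using unit_plans_weighted(1)[where \<omega> = "\<lambda>k c. \<beta> $ c - \<omega> k c" and m = "\<lambda>k. - \<alpha> k", OF f le]
    unfolding eq neg by linarith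
  have "\<beta> \<bullet> col_sums f - cost \<omega> f = - sum \<alpha> UNIV \<longleftrightarrow> f \<in> unit_plans B"
    using unit_plans_weighted(2)[where \<omega> = "\<lambda>k c. \<beta> $ c - \<omega> k c" and m = "\<lambda>k. - \<alpha> k", OF f le]
    unfolding eq neg B .
  then show "\<beta> \<bullet> col_sums f + sum \<alpha> UNIV = cost \<omega> f \<longleftrightarrow> f \<in> unit_plans B" by linarith
qed

text \<open>Let \<open>g\<close> be a plan on \<open>B'\<close> over the same point. Both plans live
  on \<open>A\<close> and on \<open>A'\<close>, and each is cheapest for its own cell, so the costs
  agree and \<open>f\<close> is tight for \<open>B'\<close> as well.\<close>

lemma refinement_plan_Int:
  fixes M :: "('n::finite \<Rightarrow> 'd::finite set) set"
  assumes M: "mixed_subdivision M"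
    and B: "B \<in> regular_refinement \<omega> M" "B' \<in> regular_refinement \<omega> M"
    and f: "f \<in> unit_plans B" and z: "col_sums f \<in> mixed_cell B'"
  shows "f \<in> unit_plans (\<lambda>k. B k \<inter> B' k)"
proof -
  obtain A \<alpha> \<beta> where A: "A \<in> M" and t: "tight_in \<omega> A \<alpha> \<beta> B" using B by (auto simp: regular_refinement_def)
  obtain A' \<alpha>' \<beta>' where A': "A' \<in> M" and t': "tight_in \<omega> A' \<alpha>' \<beta>' B'" using B by (auto simp: regular_refinement_def)
  obtain g where g: "g \<in> unit_plans B'" and eq: "col_sums g = col_sums f"
    using z unfolding mixed_cell_eq by auto
  have fA: "f \<in> unit_plans A" by (rule unit_plans_mono[OF f]) (rule tight_in_subset[OF t])
  have gA: "g \<in> unit_plans A'" by (rule unit_plans_mono[OF g]) (rule tight_in_subset[OF t'])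
  have "col_sums f \<in> mixed_cell A'" "col_sums g \<in> mixed_cell A"
    using fA gA eq unfolding mixed_cell_eq by (metis imageI)+
  then have "f \<in> unit_plans (\<lambda>k. A k \<inter> A' k)" "g \<in> unit_plans (\<lambda>k. A' k \<inter> A k)"
    using mixed_subdivision_plan_Int[OF M] A A' fA gA by blast+
  then have fA': "f \<in> unit_plans A'" and gA': "g \<in> unit_plans A"
    using unit_plans_mono[of f "\<lambda>k. A k \<inter> A' k" A'] unit_plans_mono[of g "\<lambda>k. A' k \<inter> A k" A] by auto
  have "cost \<omega> f \<le> cost \<omega> g" 
    using tight_in_cost(2)[OF t fA] tight_in_cost(1)[OF t gA'] f eq by simp
  moreover have "cost \<omega> g \<le> cost \<omega> f"
    using tight_in_cost(2)[OF t' gA] tight_in_cost(1)[OF t' fA'] g eq by simp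
  ultimately have "cost \<omega> f = cost \<omega> g" by simp
  then have "f \<in> unit_plans B'"
    using tight_in_cost(2)[OF t' fA'] tight_in_cost(2)[OF t' gA] g eq by simp
  then show ?thesis using f by (auto simp: unit_plans_def plan_def supported_def)
qed

text \<open>Tilting the potentials slightly in direction \<open>a\<close> makes slack exactly those
  edges of \<open>B\<close> that miss the row maximum of \<open>a\<close>, and edges that were slack
  remain so for small \<open>\<epsilon>\<close>.\<close>

lemma refinement_max_type:
  fixes M :: "('n::finite \<Rightarrow> 'd::finite set) set"
  assumes B: "B \<in> regular_refinement \<omega> M"
  shows "max_type a B \<in> regular_refinement \<omega> M"
proof -
  obtain A \<alpha> \<beta> where A: "A \<in> M" and t: "tight_in \<omega> A \<alpha> \<beta> B" using B by (auto simp: regular_refinement_def)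
  have Bne: "B k \<noteq> {}" for k using t unfolding tight_in_def by (elim conjE allE)
  have "B = (\<lambda>k. {c \<in> A k. \<alpha> k + \<beta> $ c = \<omega> k c})" using t unfolding tight_in_def by (elim conjE)
  then have BA: "c \<in> B k \<longleftrightarrow> c \<in> A k \<and> \<alpha> k + \<beta> $ c = \<omega> k c" for k c by simp
  have le: "\<alpha> k + \<beta> $ c \<le> \<omega> k c" if "c \<in> A k" for k c using t that by (simp add: tight_in_def)
  define m where "m = (\<lambda>k. Max ((($) a) ` B k))"
  have m: "a $ c \<le> m k" if "c \<in> B k" for c k using that by (simp add: m_def)
  have m_in: "m k \<in> (($) a) ` B k" for k unfolding m_def using Bne by (intro Max_in) auto
  have mt: "c \<in> max_type a B k \<longleftrightarrow> c \<in> B k \<and> a $ c = m k" for c k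
    using m[of _ k] m_in[of k] by (auto simp: max_type_def intro: antisym)
  have "\<forall>\<^sub>F \<epsilon> in at_right 0. \<forall>k c. c \<in> A k \<longrightarrow> c \<notin> B k \<longrightarrow> 0 < \<omega> k c - \<alpha> k - \<beta> $ c + \<epsilon> * (m k - a $ c)"
  proof (intro eventually_all_finite)
    fix k c
    show "\<forall>\<^sub>F \<epsilon> in at_right 0. c \<in> A k \<longrightarrow> c \<notin> B k \<longrightarrow> 0 < \<omega> k c - \<alpha> k - \<beta> $ c + \<epsilon> * (m k - a $ c)"
    proof (cases "c \<in> A k \<and> c \<notin> B k")
      case True
      then have "0 < \<omega> k c - \<alpha> k - \<beta> $ c" using le[of c k] BA[of c k] by auto
      moreover have "((\<lambda>\<epsilon>. \<omega> k c - \<alpha> k - \<beta> $ c + \<epsilon> * (m k - a $ c)) \<longlongrightarrow>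
          \<omega> k c - \<alpha> k - \<beta> $ c + 0 * (m k - a $ c)) (at_right 0)"
        by (intro tendsto_intros)
      ultimately have "\<forall>\<^sub>F \<epsilon> in at_right 0. 0 < \<omega> k c - \<alpha> k - \<beta> $ c + \<epsilon> * (m k - a $ c)"
        by (intro order_tendstoD) auto
      then show ?thesis by eventually_elim simp
    qed auto
  qed
  then have "\<forall>\<^sub>F \<epsilon> in at_right 0. 0 < \<epsilon> \<and>
      (\<forall>k c. c \<in> A k \<longrightarrow> c \<notin> B k \<longrightarrow> 0 < \<omega> k c - \<alpha> k - \<beta> $ c + \<epsilon> * (m k - a $ c))"
    using eventually_at_right_less[of 0] by eventually_elim simp
  then obtain \<epsilon> :: real where e: "0 < \<epsilon>"
    "\<And>k c. c \<in> A k \<Longrightarrow> c \<notin> B k \<Longrightarrow> 0 < \<omega> k c - \<alpha> k - \<beta> $ c + \<epsilon> * (m k - a $ c)"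
    using eventually_happens'[OF trivial_limit_at_right_real] by blast
  define \<alpha>' where "\<alpha>' = (\<lambda>k. \<alpha> k - \<epsilon> * m k)"
  define \<beta>' where "\<beta>' = \<beta> + \<epsilon> *\<^sub>R a"
  have slack: "\<omega> k c - (\<alpha>' k + \<beta>' $ c) = \<omega> k c - \<alpha> k - \<beta> $ c + \<epsilon> * (m k - a $ c)" for k c
    by (simp add: \<alpha>'_def \<beta>'_def algebra_simps)
  have slackB: "\<omega> k c - (\<alpha>' k + \<beta>' $ c) = \<epsilon> * (m k - a $ c)" if "c \<in> B k" for k c
    using slack[of k c] BA[of c k] that by simp
  have le': "\<alpha>' k + \<beta>' $ c \<le> \<omega> k c" if "c \<in> A k" for k c
  proof (cases "c \<in> B k")
    case True
    then have "0 \<le> \<epsilon> * (m k - a $ c)" using e(1) m by simp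
    then show ?thesis using slackB[OF True] by linarith
  next
    case False
    then show ?thesis using e(2)[OF that False] slack[of k c] by linarith
  qed
  have eq': "\<alpha>' k + \<beta>' $ c = \<omega> k c \<longleftrightarrow> c \<in> max_type a B k" if "c \<in> A k" for k c
  proof (cases "c \<in> B k")
    case True
    have "\<alpha>' k + \<beta>' $ c = \<omega> k c \<longleftrightarrow> \<epsilon> * (m k - a $ c) = 0" using slackB[OF True] by linarith
    then show ?thesis using e(1) True mt by auto
  next
    case False
    then show ?thesis using e(2)[OF that False] slack[of k c] mt by auto
  qed
  have "max_type a B = (\<lambda>k. {c \<in> A k. \<alpha>' k + \<beta>' $ c = \<omega> k c})"
  proof (intro ext set_eqI)
    fix k c show "c \<in> max_type a B k \<longleftrightarrow> c \<in> {c \<in> A k. \<alpha>' k + \<beta>' $ c = \<omega> k c}"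
      using eq'[of c k] mt[of c k] BA[of c k] by blast
  qed
  moreover have "max_type a B k \<noteq> {}" for k by (rule max_type_nonempty) (rule Bne)
  ultimately have "tight_in \<omega> A \<alpha>' \<beta>' (max_type a B)" using le' unfolding tight_in_def by blast
  then show ?thesis using A unfolding regular_refinement_def by blast
qed

text \<open>For the face property, combine plans over the endpoints into a plan over the inner
  point. It is supported on the intersection, and by nonnegativity both endpoint plans vanish
  wherever it does.\<close>

lemma refinement_face_of:
  fixes M :: "('n::finite \<Rightarrow> 'd::finite set) set"
  assumes M: "mixed_subdivision M"
    and B: "B \<in> regular_refinement \<omega> M" "B' \<in> regular_refinement \<omega> M"
  shows "mixed_cell B \<inter> mixed_cell B' = mixed_cell (\<lambda>k. B k \<inter> B' k)"
    and "(mixed_cell B \<inter> mixed_cell B') face_of mixed_cell B"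
proof -
  let ?I = "\<lambda>k. B k \<inter> B' k"
  have sub: "mixed_cell ?I \<subseteq> mixed_cell B" "mixed_cell ?I \<subseteq> mixed_cell B'"
    by (rule mixed_cell_mono; blast)+
  show eq: "mixed_cell B \<inter> mixed_cell B' = mixed_cell ?I"
  proof
    show "mixed_cell B \<inter> mixed_cell B' \<subseteq> mixed_cell ?I"
    proof
      fix z assume z: "z \<in> mixed_cell B \<inter> mixed_cell B'"
      then obtain f where f: "f \<in> unit_plans B" "z = col_sums f" unfolding mixed_cell_eq by blast
      then have "f \<in> unit_plans ?I" using refinement_plan_Int[OF M B f(1)] z by blast
      then show "z \<in> mixed_cell ?I" using f(2) unfolding mixed_cell_eq by blast
    qed
  qed (use sub in blast)
  show "(mixed_cell B \<inter> mixed_cell B') face_of mixed_cell B"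
    unfolding eq face_of_def
  proof (intro conjI sub(1) ballI impI)
    show "convex (mixed_cell ?I)" by (intro polytope_imp_convex polytope_mixed_cell)
    fix a b x assume a: "a \<in> mixed_cell B" and b: "b \<in> mixed_cell B" and x: "x \<in> mixed_cell ?I"
      and seg: "x \<in> open_segment a b"
    obtain f where f: "f \<in> unit_plans B" "a = col_sums f" using a unfolding mixed_cell_eq by blast
    obtain g where g: "g \<in> unit_plans B" "b = col_sums g" using b unfolding mixed_cell_eq by blast
    obtain u where u: "0 < u" "u < 1" "x = (1 - u) *\<^sub>R a + u *\<^sub>R b" using seg by (auto simp: in_segment)
    define h where "h = (1 - u) *\<^sub>R f + u *\<^sub>R g"
    have "row_sums h = ((1 - u) + u) *\<^sub>R 1"
      using f g unfolding h_def scaleR_add_left by (simp add: sums_linear unit_plans_def del: scaleR_left_diff_distrib)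
    moreover have "0 \<le> h $ k $ c" for k c using f g u by (simp add: h_def unit_plans_def plan_def)
    ultimately have "h \<in> unit_plans B" using f g by (auto simp: h_def unit_plans_def plan_def supported_def)
    moreover have "col_sums h \<in> mixed_cell B'"
      using x u(3) sub(2) by (auto simp: h_def sums_linear f(2) g(2))
    ultimately have h: "h \<in> unit_plans ?I" by (rule refinement_plan_Int[OF M B])
    have "f $ k $ c = 0 \<and> g $ k $ c = 0" if "c \<notin> ?I k" for k c
    proof -
      have "(1 - u) * f $ k $ c + u * g $ k $ c = 0"
        using h that by (simp add: unit_plans_def plan_def supported_def h_def)
      moreover have "0 \<le> (1 - u) * f $ k $ c" "0 \<le> u * g $ k $ c"
        using f g u by (simp_all add: unit_plans_def plan_def)
      ultimately have "(1 - u) * f $ k $ c = 0" "u * g $ k $ c = 0" by linarith+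
      then show ?thesis using u by simp
    qed
    then have "f \<in> unit_plans ?I" "g \<in> unit_plans ?I"
      using f g by (simp_all add: unit_plans_def plan_def supported_def)
    then show "a \<in> mixed_cell ?I" "b \<in> mixed_cell ?I" using f(2) g(2) unfolding mixed_cell_eq by blast+
  qed
qed

text \<open>Linear programming duality for the cost that charges a single edge: \<open>f\<close>
  minimises this entry among the plans over \<open>z\<close>, and if the minimum is positive the
  potentials come from a cut.\<close>

lemma edge_optimal_plan:
  fixes A :: "'n::finite \<Rightarrow> 'd::finite set"
  assumes z: "z \<in> mixed_cell A"
  shows "\<exists>f \<alpha> (\<beta> :: real ^ 'd). f \<in> unit_plans A \<and> col_sums f = z \<and>
    (\<forall>k c. c \<in> A k \<longrightarrow> \<alpha> k + \<beta> $ c \<le> of_bool (k = k0 \<and> c = c0)) \<and>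
    (\<forall>k c. 0 < f $ k $ c \<longrightarrow> \<alpha> k + \<beta> $ c = of_bool (k = k0 \<and> c = c0))"
proof -
  let ?S = "unit_plans A \<inter> {f. col_sums f = z}"
  have "compact ?S" by (intro compact_Int_closed compact_unit_plans closed_Collect_eq continuous_intros)
  moreover have "?S \<noteq> {}" using z unfolding mixed_cell_eq by blast
  moreover have "continuous_on ?S (\<lambda>f. f $ k0 $ c0)" by (intro continuous_intros)
  ultimately obtain f where f: "f \<in> ?S" and min: "\<And>g. g \<in> ?S \<Longrightarrow> f $ k0 $ c0 \<le> g $ k0 $ c0"
    using continuous_attains_inf[of ?S "\<lambda>f. f $ k0 $ c0"] by blast
  have fA: "f \<in> unit_plans A" and fz: "col_sums f = z" using f by auto
  have nn: "0 \<le> f $ k $ c" for k c using fA by (simp add: unit_plans_def plan_def)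
  have fin: "c \<in> A k" if "0 < f $ k $ c" for k c
    using that fA by (cases "c \<in> A k") (auto simp: unit_plans_def plan_def supported_def)
  show ?thesis
  proof (cases "f $ k0 $ c0 = 0")
    case True
    show ?thesis
      by (rule exI[of _ f], rule exI[of _ "\<lambda>k. 0"], rule exI[of _ 0]) (use True fA fz in auto)
  next
    case False
    then have pos: "0 < f $ k0 $ c0" using nn[of k0 c0] by simp
    \<comment> \<open>The residual graph of \<open>f\<close> without the edge
      \<open>(k0, c0)\<close>: mass can be added on edges of \<open>A\<close> and removed where
      \<open>f\<close> is positive.\<close>
    define X where "X = (\<lambda>k. {c \<in> A k. \<not> (k = k0 \<and> c = c0)})"
    define Y where "Y = (\<lambda>k. {c. 0 < f $ k $ c \<and> \<not> (k = k0 \<and> c = c0)})"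
    define U where "U = {u. (Inl k0, u) \<in> (walk_step X Y)\<^sup>*}"
    have k0U: "Inl k0 \<in> U" by (simp add: U_def)
    have UX: "Inr c \<in> U" if "Inl k \<in> U" "c \<in> X k" for k c
    proof -
      have "(Inl k, Inr c) \<in> walk_step X Y" using that by (auto simp: walk_step_def)
      then show ?thesis using that unfolding U_def by (auto intro: rtrancl_into_rtrancl)
    qed
    have UY: "Inl k \<in> U" if "Inr c \<in> U" "c \<in> Y k" for k c
    proof -
      have "(Inr c, Inl k) \<in> walk_step X Y" using that by (auto simp: walk_step_def)
      then show ?thesis using that unfolding U_def by (auto intro: rtrancl_into_rtrancl)
    qed
    have c0U: "Inr c0 \<notin> U"
    proof
      assume "Inr c0 \<in> U"
      then have walk: "(Inl k0, Inr c0) \<in> (walk_step X Y)\<^sup>*" by (simp add: U_def)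
      obtain g h where g: "plan Y g" and h: "plan X h"
        and r: "\<And>k. row_sums h $ k - row_sums g $ k = of_bool (k0 = k)"
        and cs: "\<And>c. col_sums g $ c - col_sums h $ c = - of_bool (c0 = c)"
        using walk_plans[OF walk] by auto
      \<comment> \<open>A walk from \<open>k0\<close> to \<open>c0\<close> is a detour for the mass
        on this edge: \<open>w\<close> preserves all sums and lowers the entry at
        \<open>(k0, c0)\<close>, against minimality.\<close>
      define w where "w = h - g - edge_plan k0 c0"
      have "row_sums w = 0"
      proof (rule vec_eq_iff[THEN iffD2], rule allI)
        fix k show "row_sums w $ k = (0 :: real ^ 'n) $ k"
          using r[of k] by (auto simp: w_def row_sums_diff row_sums_edge axis_def)
      qed
      have "col_sums w = 0"
      proof (rule vec_eq_iff[THEN iffD2], rule allI)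
        fix c show "col_sums w $ c = (0 :: real ^ 'd) $ c"
          using cs[of c] by (auto simp: w_def col_sums_diff col_sums_edge axis_def)
      qed
      have "\<forall>\<^sub>F \<epsilon> in at_right 0. \<forall>k c. 0 \<le> f $ k $ c + \<epsilon> * w $ k $ c"
      proof (intro eventually_all_finite)
        fix k c
        show "\<forall>\<^sub>F \<epsilon> in at_right 0. 0 \<le> f $ k $ c + \<epsilon> * w $ k $ c"
        proof (cases "0 < f $ k $ c")
          case True
          have "((\<lambda>\<epsilon>. f $ k $ c + \<epsilon> * w $ k $ c) \<longlongrightarrow> f $ k $ c + 0 * w $ k $ c) (at_right 0)"
            by (intro tendsto_intros)
          then have "\<forall>\<^sub>F \<epsilon> in at_right 0. 0 < f $ k $ c + \<epsilon> * w $ k $ c"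
            by (rule order_tendstoD) (use True in simp)
          then show ?thesis by eventually_elim simp
        next
          case False
          then have "g $ k $ c = 0" "edge_plan k0 c0 $ k $ c = 0"
            using g pos by (auto simp: plan_def supported_def Y_def edge_plan_def)
          then have "0 \<le> w $ k $ c" using h by (simp add: w_def plan_def)
          moreover have "\<forall>\<^sub>F \<epsilon> in at_right 0. (0::real) < \<epsilon>" by (rule eventually_at_right_less)
          ultimately show ?thesis using nn[of k c] by (auto elim!: eventually_mono)
        qed
      qed
      then have "\<forall>\<^sub>F \<epsilon> in at_right 0. 0 < \<epsilon> \<and> (\<forall>k c. 0 \<le> f $ k $ c + \<epsilon> * w $ k $ c)"
        using eventually_at_right_less[of 0] by eventually_elim simp
      then obtain \<epsilon> :: real where e: "0 < \<epsilon>" "\<And>k c. 0 \<le> f $ k $ c + \<epsilon> * w $ k $ c"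
        using eventually_happens'[OF trivial_limit_at_right_real] by blast
      have "w $ k $ c = 0" if "c \<notin> A k" for k c
      proof -
        have "c \<notin> X k" "c \<notin> Y k" "\<not> (k = k0 \<and> c = c0)" using that fin pos by (auto simp: X_def Y_def)
        then show ?thesis using g h by (simp add: w_def plan_def supported_def edge_plan_def)
      qed
      then have "f + \<epsilon> *\<^sub>R w \<in> ?S"
        using e fA fz \<open>row_sums w = 0\<close> \<open>col_sums w = 0\<close>
        by (simp add: unit_plans_def plan_def supported_def sums_linear)
      then have "f $ k0 $ c0 \<le> (f + \<epsilon> *\<^sub>R w) $ k0 $ c0" by (rule min)
      moreover have "w $ k0 $ c0 = -1"
        using g h by (simp add: w_def plan_def supported_def edge_plan_def X_def Y_def)
      ultimately show False using e by simp
    qed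
    \<comment> \<open>The cut \<open>U\<close> of the residual graph separates \<open>k0\<close> from \<open>c0\<close> and serves as potential.\<close>
    define \<alpha> :: "'n \<Rightarrow> real" where "\<alpha> = (\<lambda>k. of_bool (Inl k \<in> U))"
    define \<beta> :: "real ^ 'd" where "\<beta> = (\<chi> c. - of_bool (Inr c \<in> U))"
    show ?thesis
    proof (intro exI[of _ f] exI[of _ \<alpha>] exI[of _ \<beta>] conjI allI impI fA fz)
      show "\<alpha> k + \<beta> $ c \<le> of_bool (k = k0 \<and> c = c0)" if "c \<in> A k" for k c
        using UX[of k c] that c0U by (auto simp: \<alpha>_def \<beta>_def X_def)
      show "\<alpha> k + \<beta> $ c = of_bool (k = k0 \<and> c = c0)" if "0 < f $ k $ c" for k c
        using UX[of k c] UY[of c k] fin[OF that] that c0U k0U by (auto simp: \<alpha>_def \<beta>_def X_def Y_def)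
    qed
  qed
qed

text \<open>The refined cells cover because an optimal plan over any point of a cell is supported on
  the tight edges of its potentials. How they meet follows from the shared heights.\<close>

lemma edge_refinement_subdivision:
  fixes M :: "('n::finite \<Rightarrow> 'd::finite set) set"
  assumes M: "mixed_subdivision M"
  shows "mixed_subdivision (regular_refinement (\<lambda>k c. of_bool (k = k0 \<and> c = c0)) M)"
proof -
  let ?\<omega> = "\<lambda>(k :: 'n) (c :: 'd). of_bool (k = k0 \<and> c = c0) :: real"
  let ?R = "regular_refinement ?\<omega> M" and ?Q = "(\<lambda>x. real CARD('n) *\<^sub>R x) ` Delta (UNIV :: 'd set)"
  have Q: "\<Union> (mixed_cell ` M) = ?Q" using M by (simp add: mixed_subdivision_def polyhedral_subdivision_def)
  have Rtight: "\<exists>A\<in>M. \<exists>\<alpha> \<beta>. tight_in ?\<omega> A \<alpha> \<beta> B" if "B \<in> ?R" for B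
    using that unfolding regular_refinement_def by (rule CollectD)
  have Rne: "B k \<noteq> {}" if "B \<in> ?R" for B k
    using Rtight[OF that] unfolding tight_in_def by (elim bexE exE conjE allE)
  have UR: "\<Union> (mixed_cell ` ?R) = ?Q"
  proof
    show "\<Union> (mixed_cell ` ?R) \<subseteq> ?Q"
    proof (rule Union_least, clarify del: subsetI)
      fix B assume "B \<in> ?R"
      then obtain A \<alpha> \<beta> where A: "A \<in> M" "tight_in ?\<omega> A \<alpha> \<beta> B" using Rtight by meson
      have "mixed_cell B \<subseteq> mixed_cell A" by (rule mixed_cell_mono) (rule tight_in_subset[OF A(2)])
      then show "mixed_cell B \<subseteq> ?Q" using Q A(1) by blast
    qed
    show "?Q \<subseteq> \<Union> (mixed_cell ` ?R)"
    proof
      fix z assume "z \<in> ?Q"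
      then obtain A where A: "A \<in> M" "z \<in> mixed_cell A" using Q by blast
      obtain f \<alpha> and \<beta> :: "real ^ 'd" where f: "f \<in> unit_plans A" "col_sums f = z"
        and le: "\<And>k c. c \<in> A k \<Longrightarrow> \<alpha> k + \<beta> $ c \<le> ?\<omega> k c"
        and eq: "\<And>k c. 0 < f $ k $ c \<Longrightarrow> \<alpha> k + \<beta> $ c = ?\<omega> k c"
        using edge_optimal_plan[OF A(2), of k0 c0] by (elim exE conjE) blast
      define B where "B = (\<lambda>k. {c \<in> A k. \<alpha> k + \<beta> $ c = ?\<omega> k c})"
      have "f $ k $ c = 0" if "c \<notin> B k" for k c
      proof (cases "c \<in> A k")
        case True
        then have "\<not> 0 < f $ k $ c" using that eq[of k c] by (auto simp: B_def)
        then show ?thesis using f(1) by (simp add: unit_plans_def plan_def order.antisym)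
      next
        case False
        then show ?thesis using f(1) by (simp add: unit_plans_def plan_def supported_def)
      qed
      then have fB: "f \<in> unit_plans B" using f(1) by (simp add: unit_plans_def plan_def supported_def)
      then have "\<forall>k. B k \<noteq> {}" by (intro allI unit_plan_nonempty)
      moreover have "\<forall>k. \<forall>c\<in>A k. \<alpha> k + \<beta> $ c \<le> ?\<omega> k c" using le by (intro allI ballI)
      ultimately have "tight_in ?\<omega> A \<alpha> \<beta> B" unfolding tight_in_def using B_def by (intro conjI)
      then have "B \<in> ?R" unfolding regular_refinement_def by (intro CollectI bexI[OF _ A(1)] exI)
      moreover have "z \<in> mixed_cell B" using fB f(2) unfolding mixed_cell_eq by blast
      ultimately show "z \<in> \<Union> (mixed_cell ` ?R)" by blast
    qed
  qed
  have faces: "F \<in> mixed_cell ` ?R" if B: "B \<in> ?R" and F: "F face_of mixed_cell B" "F \<noteq> {}" for B F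
  proof -
    obtain a where "F = mixed_cell (max_type a B)"
      by (rule face_of_mixed_cell[of B F, OF Rne[OF B] F])
    then show ?thesis using refinement_max_type[OF B] by (rule image_eqI)
  qed
  have "polyhedral_subdivision ?Q (mixed_cell ` ?R)"
    unfolding polyhedral_subdivision_def ball_simps
  proof (intro conjI ballI allI impI UR polytope_mixed_cell)
    show "finite (mixed_cell ` ?R)" by simp
    fix B assume B: "B \<in> ?R"
    show "mixed_cell B \<noteq> {}" by (rule mixed_cell_nonempty) (rule Rne[OF B])
    show "F \<in> mixed_cell ` ?R" if "F face_of mixed_cell B \<and> F \<noteq> {}" for F using faces[OF B] that by simp
    fix B' assume B': "B' \<in> ?R"
    show "(mixed_cell B \<inter> mixed_cell B') face_of mixed_cell B" by (rule refinement_face_of(2)[OF M B B'])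
    show "(mixed_cell B \<inter> mixed_cell B') face_of mixed_cell B'"
      using refinement_face_of(2)[OF M B' B] by (simp only: Int_commute)
  qed
  moreover have "\<forall>A\<in>?R. \<forall>B\<in>?R. mixed_cell A \<inter> mixed_cell B = minkowski_sum (\<lambda>i. Delta (A i) \<inter> Delta (B i))"
    unfolding minkowski_sum_Delta_Int by (intro ballI refinement_face_of(1)[OF M])
  moreover have "\<forall>A\<in>?R. \<forall>i. A i \<noteq> {}" by (intro ballI allI Rne)
  ultimately show ?thesis unfolding mixed_subdivision_def by (intro conjI)
qed

section \<open>Consequences of fineness: forests and downward closure\<close>

text \<open>A fine subdivision equals its refinement by the heights of one edge, so every edge of
  \<open>A\<close> is tight for suitable potentials, and tightness is the required equation.\<close>

lemma fine_edge_potentials: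
  fixes M :: "('n::finite \<Rightarrow> 'd::finite set) set" and A :: "'n \<Rightarrow> 'd set"
  assumes M: "fine_mixed_subdivision M" and A: "A \<in> M"
  shows "edge_potentials A"
  unfolding edge_potentials_def
proof (intro allI ballI)
  fix k0 :: 'n and c0 :: 'd
  let ?\<omega> = "\<lambda>(k :: 'n) (c :: 'd). of_bool (k = k0 \<and> c = c0) :: real"
  have "mixed_refines (regular_refinement ?\<omega> M) M"
    unfolding mixed_refines_def
  proof
    fix B assume "B \<in> regular_refinement ?\<omega> M"
    then obtain A' \<alpha> \<beta> where A': "A' \<in> M" "tight_in ?\<omega> A' \<alpha> \<beta> B"
      unfolding regular_refinement_def mem_Collect_eq by (elim bexE exE)
    show "\<exists>A\<in>M. \<forall>k. B k \<subseteq> A k" using tight_in_subset[OF A'(2)] A'(1) by (intro bexI[of _ A'] allI)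
  qed
  moreover have "mixed_subdivision (regular_refinement ?\<omega> M)"
    using M by (intro edge_refinement_subdivision) (simp add: fine_mixed_subdivision_def)
  ultimately have "regular_refinement ?\<omega> M = M" using M by (simp add: fine_mixed_subdivision_def)
  then have "A \<in> regular_refinement ?\<omega> M" using A by (simp only:)
  then obtain A' \<alpha> and \<beta> :: "real ^ 'd" where "tight_in ?\<omega> A' \<alpha> \<beta> A"
    unfolding regular_refinement_def mem_Collect_eq by (elim bexE exE)
  then have "\<forall>k. \<forall>c\<in>A k. (\<chi> k. \<alpha> k) $ k + \<beta> $ c = ?\<omega> k c" unfolding tight_in_def by (elim conjE) simp
  then show "\<exists>(\<alpha> :: real ^ 'n) (\<beta> :: real ^ 'd). \<forall>k. \<forall>c\<in>A k. \<alpha> $ k + \<beta> $ c = ?\<omega> k c" by (intro exI)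
qed

text \<open>The functional \<open>- \<beta>\<close> is constant on each row of \<open>A\<close>
  except that it drops by 1 at \<open>c0\<close> in row \<open>k0\<close>. The face maximising it
  therefore loses just this edge, and \<open>c1\<close> keeps the row nonempty.\<close>

lemma fine_remove_edge:
  fixes M :: "('n::finite \<Rightarrow> 'd::finite set) set"
  assumes M: "fine_mixed_subdivision M" and A: "A \<in> M" and c: "c0 \<in> A k0" "c1 \<in> A k0" "c1 \<noteq> c0"
  shows "A(k0 := A k0 - {c0}) \<in> M"
proof -
  obtain \<alpha> :: "real ^ 'n" and \<beta> :: "real ^ 'd"
    where ab: "\<And>k c. c \<in> A k \<Longrightarrow> \<alpha> $ k + \<beta> $ c = of_bool (k = k0 \<and> c = c0)"
    using fine_edge_potentials[OF M A] c(1) unfolding edge_potentials_def by blast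
  have b: "(- \<beta>) $ c = \<alpha> $ k - of_bool (k = k0 \<and> c = c0)" if "c \<in> A k" for k c
    using ab[OF that] by simp
  have "max_type (- \<beta>) A = A(k0 := A k0 - {c0})"
  proof (intro ext set_eqI)
    fix k c
    show "c \<in> max_type (- \<beta>) A k \<longleftrightarrow> c \<in> (A(k0 := A k0 - {c0})) k"
    proof (cases "k = k0")
      case True
      have "(\<forall>c'\<in>A k. (- \<beta>) $ c' \<le> (- \<beta>) $ c) \<longleftrightarrow> c \<noteq> c0" if "c \<in> A k"
      proof
        assume "\<forall>c'\<in>A k. (- \<beta>) $ c' \<le> (- \<beta>) $ c"
        then have "(- \<beta>) $ c1 \<le> (- \<beta>) $ c" using c True by blast
        then show "c \<noteq> c0" using b[of c1 k] b[of c k] that c True by auto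
      next
        assume "c \<noteq> c0"
        then show "\<forall>c'\<in>A k. (- \<beta>) $ c' \<le> (- \<beta>) $ c"
          unfolding b[OF that] using b[of _ k] by (simp del: vector_uminus_component)
      qed
      then show ?thesis using True by (auto simp: max_type_def simp del: vector_uminus_component)
    next
      case False
      then have "\<forall>c'\<in>A k. (- \<beta>) $ c' = \<alpha> $ k" using b[of _ k] by (simp del: vector_uminus_component)
      then show ?thesis using False by (auto simp: max_type_def simp del: vector_uminus_component)
    qed
  qed
  then show ?thesis
    using mixed_subdivision_max_type[of M A "- \<beta>"] M A by (simp add: fine_mixed_subdivision_def)
qed

text \<open>Surplus edges are deleted one at a time; an element of \<open>B k0\<close> provides the
  second edge that each deletion in row \<open>k0\<close> requires.\<close>

lemma fine_downward:
  fixes M :: "('n::finite \<Rightarrow> 'd::finite set) set"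
  assumes M: "fine_mixed_subdivision M" and A: "A \<in> M" and BA: "\<And>k. B k \<subseteq> A k" and B: "\<And>k. B k \<noteq> {}"
  shows "B \<in> M"
  using A BA
proof (induction "\<Sum>k\<in>UNIV. card (A k - B k)" arbitrary: A rule: less_induct)
  case less
  show ?case
  proof (cases "A = B")
    case True
    then show ?thesis using less.prems by simp
  next
    case False
    then obtain k0 where "A k0 \<noteq> B k0" by (auto simp: fun_eq_iff)
    then obtain c0 where c0: "c0 \<in> A k0" "c0 \<notin> B k0" using less.prems(2)[of k0] by blast
    obtain c1 where c1: "c1 \<in> B k0" using B[of k0] by blast
    let ?A = "A(k0 := A k0 - {c0})"
    have "?A \<in> M" using c0 c1 less.prems by (intro fine_remove_edge[OF M, of A c0 k0 c1]) auto
    moreover have "B k \<subseteq> ?A k" for k using less.prems(2)[of k] c0 by auto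
    moreover have "(\<Sum>k\<in>UNIV. card (?A k - B k)) < (\<Sum>k\<in>UNIV. card (A k - B k))"
    proof (rule sum_strict_mono_ex1)
      show "\<forall>k\<in>UNIV. card (?A k - B k) \<le> card (A k - B k)" by (auto intro!: card_mono)
      have "card (?A k0 - B k0) < card (A k0 - B k0)" using c0 by (intro psubset_card_mono) auto
      then show "\<exists>k\<in>UNIV. card (?A k - B k) < card (A k - B k)" by blast
    qed simp
    ultimately show ?thesis using less.hyps[of ?A] by blast
  qed
qed

text \<open>For uniqueness: \<open>g\<close> lies over a point of cell \<open>A\<close>, so it is
  supported on \<open>A\<close> too, and there the potentials recover a plan from its sums.\<close>

lemma fine_plan_complex:
  fixes M :: "('n::finite \<Rightarrow> 'd::finite set) set"
  assumes M: "fine_mixed_subdivision M"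
  shows "plan_complex M"
proof
  have M': "mixed_subdivision M" using M by (simp add: fine_mixed_subdivision_def)
  fix A B :: "'n \<Rightarrow> 'd set" and k f g
  show "A k \<noteq> {}" if "A \<in> M" by (rule mixed_subdivision_nonempty[OF M' that])
  show "edge_potentials A" if "A \<in> M" by (rule fine_edge_potentials[OF M that])
  show "B \<in> M" if "A \<in> M" "\<And>k. B k \<subseteq> A k" "\<And>k. B k \<noteq> {}" using fine_downward[OF M] that by blast
  show "\<exists>A\<in>M. \<nu> \<in> col_sums ` unit_plans A"
    if "\<And>c. 0 \<le> \<nu> $ c" "(\<Sum>c\<in>UNIV. \<nu> $ c) = real CARD('n)" for \<nu> :: "real ^ 'd"
  proof -
    have "\<nu> \<in> (\<lambda>x. real CARD('n) *\<^sub>R x) ` Delta UNIV" using that unfolding dilated_simplex_iff by blast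
    also have "\<dots> = \<Union> (mixed_cell ` M)"
      using M' by (simp add: mixed_subdivision_def polyhedral_subdivision_def)
    finally show ?thesis unfolding mixed_cell_eq by blast
  qed
  show "f = g" if A: "A \<in> M" "B \<in> M" and f: "f \<in> unit_plans A" and g: "g \<in> unit_plans B"
    and eq: "col_sums f = col_sums g"
  proof (rule supported_eqI[OF fine_edge_potentials[OF M A(1)] _ _ _ eq])
    have "col_sums g \<in> mixed_cell A" using f eq[symmetric] unfolding mixed_cell_eq by simp
    then have "g \<in> unit_plans (\<lambda>k. B k \<inter> A k)"
      by (rule mixed_subdivision_plan_Int[OF M' A(2,1) g])
    then show "supported A g" by (auto simp: unit_plans_def plan_def supported_def)
    show "supported A f" "row_sums f = row_sums g" using f g by (auto simp: unit_plans_def plan_def)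
  qed
qed

theorem theorem6p7:
  fixes H :: "'n::finite \<Rightarrow> (ereal ^ 'd::finite) set"
    and S :: "'n \<Rightarrow> 'd \<Rightarrow> (ereal ^ 'd) set"
    and M :: "('n \<Rightarrow> 'd set) set"
  assumes "tropical_pseudo_arrangement H S"
    and "fine_mixed_subdivision M"
    and "tropical_types S = M"
  shows "\<forall>A\<in>tropical_types S. \<forall>B\<in>tropical_types S. \<forall>j. \<exists>C\<in>tropical_types S.
           C j = A j \<union> B j \<and> (\<forall>k. C k \<in> {A k, B k, A k \<union> B k})"
  using plan_complex.elimination[OF fine_plan_complex[OF assms(2)]] unfolding assms(3) by blast

end
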